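(* Let $F(z)=\sum_{n=0}^\infty c_nz^n$ be analytic on the unit disc $\mathbb{D}$. (i) Suppose the sequence $\{c_n\}_{n\geq0}$ is bounded from below. If $F(z)/(z-1)$ has pseudomeasure boundary behavior at $z=1$, then $\sum_{n=0}^Nc_n=O(1)$. (ii) Suppose that $\liminf_{n\to\infty}c_n\geq0$. If there is a constant $F(1)$ such that $(F(z)-F(1))/(z-1)$ has pseudofunction boundary behavior at $z=1$, then $\sum_{n=0}^\infty c_n$ converges to $F(1)$.
   Context: Fourier transform $\hat\varphi(t)=\int e^{-itx}\varphi(x)\,\mathrm{d}x$. A tempered distribution $g$ is a pseudomeasure if $\hat g\in L^\infty$, a pseudofunction if moreover $\hat g(x)\to0$ as $|x|\to\infty$. An analytic function $H$ on $\mathbb{D}$ has pseudofunction (pseudomeasure) boundary behavior at $e^{i\theta_0}$ if there is an open interval $U\ni\theta_0$ such that $H(re^{i\theta})$ converges in $\mathcal{D}'(U)$ (as distributions in $\theta$) as $r\to1^-$ to a distribution that coincides near each point of $U$ with a pseudofunction (pseudomeasure). *)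

theory Defs
  imports "HOL-Analysis.Analysis" "HOL-Library.Landau_Symbols"
begin

definition smooth_fun :: "(real \<Rightarrow> complex) \<Rightarrow> bool" where
  "smooth_fun \<phi> \<longleftrightarrow>
     (\<exists>D :: nat \<Rightarrow> real \<Rightarrow> complex. D 0 = \<phi> \<and>
        (\<forall>n x. (D n has_vector_derivative D (Suc n) x) (at x)))"

definition test_fun :: "real set \<Rightarrow> (real \<Rightarrow> complex) \<Rightarrow> bool" where
  "test_fun U \<phi> \<longleftrightarrow> smooth_fun \<phi> \<and>
     compact (closure {x. \<phi> x \<noteq> 0}) \<and> closure {x. \<phi> x \<noteq> 0} \<subseteq> U"

definition fourier :: "(real \<Rightarrow> complex) \<Rightarrow> real \<Rightarrow> complex" where
  "fourier \<phi> t = (LINT x|lborel. exp (- \<i> * complex_of_real (t * x)) * \<phi> x)"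

text \<open>The action on a test function of the tempered distribution g whose Fourier
  transform is the (bounded measurable) function G:
  g(phi) = (1/(2 pi)) * integral of G(t) * hat phi(-t) dt.\<close>
definition ft_inv_pair :: "(real \<Rightarrow> complex) \<Rightarrow> (real \<Rightarrow> complex) \<Rightarrow> complex" where
  "ft_inv_pair G \<phi> = (LINT t|lborel. G t * fourier \<phi> (- t)) / complex_of_real (2 * pi)"

text \<open>Fourier transforms of pseudomeasures: L-infinity functions (bounded representative);
  of pseudofunctions: moreover tending to 0 at infinity.\<close>
definition pm_symbol :: "(real \<Rightarrow> complex) \<Rightarrow> bool" where
  "pm_symbol G \<longleftrightarrow> G \<in> borel_measurable lborel \<and> bounded (range G)"

definition pf_symbol :: "(real \<Rightarrow> complex) \<Rightarrow> bool" where
  "pf_symbol G \<longleftrightarrow> pm_symbol G \<and> (G \<longlongrightarrow> 0) at_infinity"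

text \<open>H has P boundary behaviour at e^{i theta0} (P = pm_symbol or pf_symbol):
  on some open interval U containing theta0, H(r e^{i theta}) converges in D'(U)
  as r \<rightarrow> 1- to some T, and T coincides near each point of U with a
  tempered distribution whose Fourier transform satisfies P.\<close>
definition boundary_behavior ::
    "((real \<Rightarrow> complex) \<Rightarrow> bool) \<Rightarrow> (complex \<Rightarrow> complex) \<Rightarrow> real \<Rightarrow> bool" where
  "boundary_behavior P H \<theta>0 \<longleftrightarrow>
     (\<exists>a b T. a < \<theta>0 \<and> \<theta>0 < b \<and>
        (\<forall>\<phi>. test_fun {a<..<b} \<phi> \<longrightarrow>
           ((\<lambda>r. LINT \<theta>|lborel. H (complex_of_real r * cis \<theta>) * \<phi> \<theta>) \<longlongrightarrow> T \<phi>) (at_left 1)) \<and>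
        (\<forall>x\<in>{a<..<b}. \<exists>V G. open V \<and> x \<in> V \<and> V \<subseteq> {a<..<b} \<and> P G \<and>
           (\<forall>\<phi>. test_fun V \<phi> \<longrightarrow> T \<phi> = ft_inv_pair G \<phi>)))"

abbreviation pseudomeasure_boundary :: "(complex \<Rightarrow> complex) \<Rightarrow> real \<Rightarrow> bool" where
  "pseudomeasure_boundary \<equiv> boundary_behavior pm_symbol"

abbreviation pseudofunction_boundary :: "(complex \<Rightarrow> complex) \<Rightarrow> real \<Rightarrow> bool" where
  "pseudofunction_boundary \<equiv> boundary_behavior pf_symbol"

end

(* With a_N = c_0 + ... + c_N - F1 one has (F z - F1) / (z - 1) = - sum a_N z^N in the disc.
   Let phi be the autocorrelation of a smooth bump supported near 0, so that
   psi(t) = hat phi(-t) is a squared modulus, hence non-negative, and decays fast. Testing the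
   boundary distribution on phi(x) exp(-i n x) shows that the Abel means of sum a_N psi(N - n)
   converge to g_n = - (1 / 2 pi) int G(t) psi(t - n) dt, where G is the bounded Fourier transform
   of the distribution near 0. A lower bound on c_n gives a_N >= - D (N + 1), and monotone
   convergence then removes the Abel factor: sum a_N psi(N - n) = g_n, with a_N = O(N) from the
   single term N = n. Since psi >= 0 and a is slowly decreasing, a large value of |a_n| persists on
   a long one-sided window and forces a large g_m in the middle of that window. Boundedness of g
   thus yields boundedness of a, and g_n -> 0 (the pseudofunction case) yields a_n -> 0. Applied
   to the imaginary parts, the same argument shows that F1 is real. *)

theory Submission
  imports Defs "HOL-Probability.Sinc_Integral"
begin

section \<open>Smooth functions and bumps\<close>

text \<open>Two demands on the kernel pull apart: the hypothesis sees only test functions supported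
  near 0, whereas removing the Abel factor and reading off a window both need non-negative weights.
  An autocorrelation reconciles them. A further obstacle is circular: linear growth is all that is
  known when boundedness is to be shown, and with it the part of the sum outside the window may
  outweigh the window. The window estimate is therefore applied first at indices that nearly
  maximise |a_j| / (1 + \<delta> |j|). Around such an index n one has |a_j| <= 2 |a_n| (1 + |j -
  n|), so the outside part is a small multiple of |a_n| itself, and the resulting bound survives
  \<delta> -> 0. These linear weights are why the kernel has to have a finite first moment. Once the
  sequence is bounded, windows of a fixed length suffice for the limit 0.\<close>

text \<open>Iterating a choice of derivatives inside \<open>S\<close> yields the whole tower
  \<open>D\<close> at once, so stability of a family under a single differentiation replaces a
  formula for the n-th derivative.\<close>

lemma smooth_fun_coinduct:
  assumes "f \<in> S"
    and step: "\<And>g. g \<in> S \<Longrightarrow> \<exists>g'\<in>S. \<forall>x. (g has_vector_derivative g' x) (at x)"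
  shows "smooth_fun f"
proof -
  obtain d where d: "\<And>g. g \<in> S \<Longrightarrow> d g \<in> S" "\<And>g x. g \<in> S \<Longrightarrow> (g has_vector_derivative d g x) (at x)"
    using step by metis
  define D where "D n = (d ^^ n) f" for n
  have "D n \<in> S" for n by (induction n) (auto simp: D_def d assms(1))
  then show ?thesis unfolding smooth_fun_def
    by (intro exI[of _ D]) (auto simp: D_def intro: d(2))
qed

lemma smooth_funE:
  assumes "smooth_fun f"
  obtains g where "smooth_fun g" "\<And>x. (f has_vector_derivative g x) (at x)"
proof -
  obtain D where D: "D 0 = f" "\<And>n x. (D n has_vector_derivative D (Suc n) x) (at x)"
    using assms unfolding smooth_fun_def by auto
  have "smooth_fun (D 1)"
    unfolding smooth_fun_def using D by (intro exI[of _ "\<lambda>n. D (Suc n)"]) auto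
  with D(2)[of 0] D(1) that show ?thesis by auto
qed

lemma smooth_fun_continuous_on:
  assumes "smooth_fun f"
  shows "continuous_on A f"
proof -
  obtain g where "\<And>x. (f has_vector_derivative g x) (at x)"
    using smooth_funE[OF assms] by metis
  then have "isCont f x" for x
    using has_vector_derivative_continuous by blast
  then show ?thesis by (simp add: continuous_at_imp_continuous_on)
qed

text \<open>The derivative of a product is a sum of two products, so closing products under addition
  gives a family stable under differentiation; it takes the place of the Leibniz formula.\<close>

inductive_set smooth_products :: "(real \<Rightarrow> complex) set" where
  prod: "smooth_fun f \<Longrightarrow> smooth_fun g \<Longrightarrow> (\<lambda>x. f x * g x) \<in> smooth_products"
| add: "u \<in> smooth_products \<Longrightarrow> v \<in> smooth_products \<Longrightarrow> (\<lambda>x. u x + v x) \<in> smooth_products"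

lemma smooth_fun_mult:
  assumes "smooth_fun f" "smooth_fun g"
  shows "smooth_fun (\<lambda>x. f x * g x)"
proof (rule smooth_fun_coinduct[where S = smooth_products])
  fix u assume "u \<in> smooth_products"
  then show "\<exists>u'\<in>smooth_products. \<forall>x. (u has_vector_derivative u' x) (at x)"
  proof induction
    case (prod f g)
    obtain f' where f': "smooth_fun f'" "\<And>x. (f has_vector_derivative f' x) (at x)"
      using smooth_funE[OF prod(1)] by metis
    obtain g' where g': "smooth_fun g'" "\<And>x. (g has_vector_derivative g' x) (at x)"
      using smooth_funE[OF prod(2)] by metis
    have "(\<lambda>x. f x * g' x + f' x * g x) \<in> smooth_products"
      by (intro smooth_products.intros prod f' g')
    moreover have "((\<lambda>x. f x * g x) has_vector_derivative f x * g' x + f' x * g x) (at x)" for x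
      by (intro has_vector_derivative_mult f' g')
    ultimately show ?case
      by (intro bexI[of _ "\<lambda>x. f x * g' x + f' x * g x"]) blast+
  next
    case (add u v)
    then obtain u' v' where "u' \<in> smooth_products" "v' \<in> smooth_products"
      "\<And>x. (u has_vector_derivative u' x) (at x)" "\<And>x. (v has_vector_derivative v' x) (at x)" by blast
    then show ?case
      by (intro bexI[of _ "\<lambda>x. u' x + v' x"]) (auto intro!: has_vector_derivative_add smooth_products.add)
  qed
qed (intro smooth_products.prod assms)

lemma smooth_fun_exp_linear: "smooth_fun (\<lambda>x. exp (c * complex_of_real x))"
proof (rule smooth_fun_coinduct[where S = "{\<lambda>x. b * exp (c * complex_of_real x) | b. True}"])
  fix g assume "g \<in> {\<lambda>x. b * exp (c * complex_of_real x) | b. True}"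
  then obtain b where g: "g = (\<lambda>x. b * exp (c * complex_of_real x))" by blast
  have "(g has_vector_derivative (b * c) * exp (c * complex_of_real x)) (at x)" for x
  proof -
    have "((\<lambda>z. b * exp (c * z)) has_field_derivative (b * c) * exp (c * complex_of_real x)) (at (complex_of_real x))"
      by (auto intro!: derivative_eq_intros)
    from has_vector_derivative_real_field[OF this] show ?thesis by (simp add: g)
  qed
  then show "\<exists>g'\<in>{\<lambda>x. b * exp (c * complex_of_real x) | b. True}. \<forall>x. (g has_vector_derivative g' x) (at x)"
    by (intro bexI[of _ "\<lambda>x. (b * c) * exp (c * complex_of_real x)"]) blast+
next
  show "(\<lambda>x. exp (c * complex_of_real x)) \<in> {\<lambda>x. b * exp (c * complex_of_real x) | b. True}"
    by (intro CollectI exI[of _ 1]) auto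
qed

lemma smooth_fun_reflect:
  assumes "smooth_fun f"
  shows "smooth_fun (\<lambda>x. f (d - x))"
proof -
  obtain D where D: "D 0 = f" "\<And>n x. (D n has_vector_derivative D (Suc n) x) (at x)"
    using assms unfolding smooth_fun_def by auto
  have "((\<lambda>x. (-1) ^ n *\<^sub>R D n (d - x)) has_vector_derivative (-1) ^ Suc n *\<^sub>R D (Suc n) (d - x)) (at x)" for n x
  proof -
    have "((D n \<circ> (\<lambda>x. d - x)) has_vector_derivative (-1) *\<^sub>R D (Suc n) (d - x)) (at x)"
      by (rule vector_diff_chain_at) (auto intro!: derivative_eq_intros D(2))
    then have "((\<lambda>x. (-1) ^ n *\<^sub>R (D n \<circ> (\<lambda>x. d - x)) x) has_vector_derivative (-1) ^ n *\<^sub>R ((-1) *\<^sub>R D (Suc n) (d - x))) (at x)"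
      by (rule bounded_linear.has_vector_derivative[OF bounded_linear_scaleR_right])
    then show ?thesis by (simp add: o_def)
  qed
  then show ?thesis unfolding smooth_fun_def
    by (intro exI[of _ "\<lambda>n x. (-1) ^ n *\<^sub>R D n (d - x)"]) (auto simp: D(1))
qed

section \<open>Flat functions at the origin and smooth bumps\<close>

text \<open>The prefactors, polynomials in 1/x, are what differentiation of exp (-1/x) produces;
  with them the family is stable under differentiation, and p = 1 is the classical flat
  function.\<close>

definition flat_poly :: "real poly \<Rightarrow> real \<Rightarrow> real" where
  "flat_poly p x = (if x > 0 then poly p (1 / x) * exp (- (1 / x)) else 0)"

lemma flat_poly_tendsto_0: "(flat_poly p \<longlongrightarrow> 0) (at 0)"
proof -
  have "((\<lambda>u::real. \<Sum>i\<le>degree p. coeff p i * (u ^ i / exp u)) \<longlongrightarrow> (\<Sum>i\<le>degree p. coeff p i * 0)) at_top"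
    by (intro tendsto_intros tendsto_power_div_exp_0)
  then have "((\<lambda>u::real. poly p u * exp (- u)) \<longlongrightarrow> 0) at_top"
    by (simp add: poly_altdef exp_minus field_simps sum_distrib_left sum_distrib_right)
  then have "((\<lambda>x::real. poly p (inverse x) * exp (- inverse x)) \<longlongrightarrow> 0) (at_right 0)"
    by (rule filterlim_compose) (rule filterlim_inverse_at_top_right)
  then have "(flat_poly p \<longlongrightarrow> 0) (at_right 0)"
    by (rule Lim_transform_eventually)
       (auto simp: eventually_at_filter flat_poly_def field_simps intro!: always_eventually)
  moreover have "(flat_poly p \<longlongrightarrow> 0) (at_left 0)"
    by (rule Lim_transform_eventually[OF tendsto_const])
       (auto simp: eventually_at_filter flat_poly_def intro!: always_eventually)
  ultimately show ?thesis by (simp add: filterlim_split_at)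
qed

text \<open>With u = 1/x one has du/dx = -u^2, so p(u) exp (-u) has derivative u^2 (p(u) - p'(u))
  exp (-u); \<open>[:0, 0, 1:]\<close> is the factor u^2.\<close>

lemma flat_poly_deriv:
  "(flat_poly p has_real_derivative flat_poly ([:0, 0, 1:] * (p - pderiv p)) x) (at x)"
proof (cases x "0 :: real" rule: linorder_cases)
  case less
  have "(flat_poly p has_real_derivative 0) (at x)"
    by (rule has_field_derivative_transform_within_open[where S = "{..<0}" and f = "\<lambda>_. 0"])
       (use less in \<open>auto simp: flat_poly_def\<close>)
  then show ?thesis using less by (simp add: flat_poly_def)
next
  case equal
  \<comment> \<open>At 0 the difference quotient is again of this type, with p multiplied by the
    variable, so its limit 0 is already known.\<close>
  have "(\<lambda>h. flat_poly p h / h) = flat_poly (pCons 0 p)"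
    by (auto simp: flat_poly_def fun_eq_iff)
  then show ?thesis
    using flat_poly_tendsto_0[of "pCons 0 p"] equal
    by (simp add: DERIV_def flat_poly_def[of _ 0])
next
  case greater
  have "((\<lambda>x. poly p (1 / x) * exp (- (1 / x))) has_real_derivative
      flat_poly ([:0, 0, 1:] * (p - pderiv p)) x) (at x)"
    using greater
    by (auto intro!: derivative_eq_intros DERIV_chain2[OF poly_DERIV] simp: flat_poly_def field_simps power2_eq_square)
  then show ?thesis
    by (rule has_field_derivative_transform_within_open[where S = "{0<..}"])
       (use greater in \<open>auto simp: flat_poly_def\<close>)
qed

lemma smooth_fun_flat: "smooth_fun (\<lambda>x. complex_of_real (flat_poly p x))"
proof (rule smooth_fun_coinduct[where S = "{\<lambda>x. complex_of_real (flat_poly p x) | p. True}"])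
  fix g assume "g \<in> {\<lambda>x. complex_of_real (flat_poly p x) | p. True}"
  then obtain p where g: "g = (\<lambda>x. complex_of_real (flat_poly p x))" by blast
  have "(g has_vector_derivative complex_of_real (flat_poly ([:0, 0, 1:] * (p - pderiv p)) x)) (at x)" for x
    unfolding g by (intro has_vector_derivative_of_real)
      (metis flat_poly_deriv has_real_derivative_iff_has_vector_derivative)
  then show "\<exists>g'\<in>{\<lambda>x. complex_of_real (flat_poly p x) | p. True}. \<forall>x. (g has_vector_derivative g' x) (at x)"
    by (intro bexI[of _ "\<lambda>x. complex_of_real (flat_poly ([:0, 0, 1:] * (p - pderiv p)) x)"]) blast+
qed blast

lemma smooth_bump_exists:
  assumes "\<delta> > 0"
  obtains \<beta> :: "real \<Rightarrow> real" where "smooth_fun (\<lambda>x. complex_of_real (\<beta> x))"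
    "\<And>x. \<beta> x \<ge> 0" "\<And>x. x \<notin> {0..\<delta>} \<Longrightarrow> \<beta> x = 0" "\<And>x. x \<in> {0<..<\<delta>} \<Longrightarrow> \<beta> x > 0"
proof
  show "smooth_fun (\<lambda>x. complex_of_real (flat_poly 1 x * flat_poly 1 (\<delta> - x)))"
    unfolding of_real_mult
    by (intro smooth_fun_mult smooth_fun_flat smooth_fun_reflect[OF smooth_fun_flat])
qed (auto simp: flat_poly_def)

section \<open>Test functions with non-negative Fourier transform\<close>

lemma integrable_continuous_vanishing:
  fixes f :: "'a::euclidean_space \<Rightarrow> 'b::{banach, second_countable_topology}"
  assumes "continuous_on UNIV f" "compact K" "\<And>x. x \<notin> K \<Longrightarrow> f x = 0"
  shows "integrable lborel f"
proof -
  have "integrable lborel (\<lambda>x. indicator K x *\<^sub>R f x)"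
    using assms(1,2) by (intro borel_integrable_compact) (auto intro: continuous_on_subset)
  moreover have "(\<lambda>x. indicator K x *\<^sub>R f x) = f"
    using assms(3) by (auto simp: fun_eq_iff indicator_def)
  ultimately show ?thesis by simp
qed

lemma integral_lborel_interval:
  fixes f :: "real \<Rightarrow> complex"
  assumes "continuous_on UNIV f" "\<And>x. x \<notin> {a..b} \<Longrightarrow> f x = 0"
  shows "(LINT x|lborel. f x) = integral {a..b} f"
proof -
  have "(LINT x|lborel. f x) = integral UNIV f"
    by (rule integral_lborel[OF integrable_continuous_vanishing[OF assms(1) compact_Icc assms(2)], symmetric])
  also have "\<dots> = integral {a..b} f"
  proof (rule integral_unique, rule has_integral_on_superset)
    show "(f has_integral integral {a..b} f) {a..b}"
      using assms(1) by (intro integrable_integral integrable_continuous_real) (auto intro: continuous_on_subset)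
  qed (use assms(2) in auto)
  finally show ?thesis .
qed

lemma vector_derivative_outside_closed:
  assumes "(f has_vector_derivative f') (at x)" "closed K" "\<And>y. y \<notin> K \<Longrightarrow> f y = 0" "x \<notin> K"
  shows "f' = (0 :: complex)"
proof -
  have "(f has_vector_derivative 0) (at x)"
    by (rule has_vector_derivative_transform_within_open[where S = "- K" and f = "\<lambda>_. 0"])
       (use assms in auto)
  with assms(1) show ?thesis
    using vector_derivative_unique_at by blast
qed

section \<open>Autocorrelations and the decay of Fourier transforms\<close>

definition autocorrelation :: "(real \<Rightarrow> complex) \<Rightarrow> real \<Rightarrow> complex" where
  "autocorrelation g x = (LINT y|lborel. cnj (g y) * g (y + x))"

text \<open>Differentiation under the integral over the fixed interval [a, b]: every derivative
  falls on the shifted factor, for which a tower is given.\<close>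

lemma smooth_fun_autocorrelation:
  assumes "smooth_fun g" "\<And>x. x \<notin> {a..b} \<Longrightarrow> g x = 0"
  shows "smooth_fun (autocorrelation g)"
proof -
  obtain D where D: "D 0 = g" "\<And>n x. (D n has_vector_derivative D (Suc n) x) (at x)"
    using assms(1) unfolding smooth_fun_def by auto
  have contD: "continuous_on A (D n)" for A n
    by (rule continuous_at_imp_continuous_on) (use has_vector_derivative_continuous[OF D(2)] in simp)
  have contg: "continuous_on A g" for A using smooth_fun_continuous_on[OF assms(1)] .
  have cont: "continuous_on (UNIV \<times> cbox a b) (\<lambda>(x, t). cnj (g t) * D n (t + x))" for n
    unfolding case_prod_unfold
    by (intro continuous_intros continuous_on_compose2[OF contg] continuous_on_compose2[OF contD]) auto
  define E where "E n x = integral (cbox a b) (\<lambda>t. cnj (g t) * D n (t + x))" for n x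
  have "(E n has_vector_derivative E (Suc n) x) (at x)" for n x
    unfolding E_def
  proof (rule leibniz_rule_vector_derivative[where U = UNIV])
    show "((\<lambda>x. cnj (g t) * D n (t + x)) has_vector_derivative cnj (g t) * D (Suc n) (t + x)) (at x)" for x t
    proof -
      have "((D n \<circ> (\<lambda>x. t + x)) has_vector_derivative 1 *\<^sub>R D (Suc n) (t + x)) (at x)"
        by (rule vector_diff_chain_at) (auto intro!: derivative_eq_intros D(2))
      then show ?thesis
        by (intro has_vector_derivative_mult_right) (simp add: o_def)
    qed
    show "(\<lambda>t. cnj (g t) * D n (t + x)) integrable_on cbox a b" for x
      by (intro integrable_continuous continuous_intros continuous_on_compose2[OF contg]
           continuous_on_compose2[OF contD]) auto
    show "continuous_on (UNIV \<times> cbox a b) (\<lambda>(x, t). cnj (g t) * D (Suc n) (t + x))"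
      by (rule cont)
  qed auto
  moreover have "E 0 = autocorrelation g"
  proof
    fix x
    show "E 0 x = autocorrelation g x"
      unfolding E_def autocorrelation_def D(1) cbox_interval
      by (rule integral_lborel_interval[symmetric])
         (use assms(2) in \<open>auto intro!: continuous_intros continuous_on_compose2[OF contg]\<close>)
  qed
  ultimately show ?thesis unfolding smooth_fun_def by blast
qed

lemma autocorrelation_eq_0:
  assumes "\<And>x. x \<notin> {a..b} \<Longrightarrow> g x = 0" "\<bar>x\<bar> > b - a"
  shows "autocorrelation g x = 0"
proof -
  have "cnj (g y) * g (y + x) = 0" for y
  proof (cases "y \<in> {a..b}")
    case True
    then have "y + x \<notin> {a..b}" using assms(2) by auto
    then show ?thesis by (simp add: assms(1))
  qed (simp add: assms(1))
  then show ?thesis unfolding autocorrelation_def by (simp only: Bochner_Integration.integral_zero)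
qed

text \<open>Fubini, then the translation x -> x - y: the character splits as
  \<open>cnj (e y) * e x\<close>, and the double integral becomes the product of
  \<open>fourier g t\<close> and its conjugate.\<close>

lemma fourier_autocorrelation:
  assumes contg: "continuous_on UNIV g" and g0: "\<And>x. x \<notin> {a..b} \<Longrightarrow> g x = 0"
  shows "fourier (autocorrelation g) t = complex_of_real ((norm (fourier g t))\<^sup>2)"
proof -
  define e where "e x = exp (- \<i> * complex_of_real (t * x))" for x
  have e_add: "e (x + y) = e x * e y" for x y
    by (simp add: e_def flip: exp_add) (simp add: algebra_simps)
  have e_cnj: "cnj (e x) = e (- x)" for x
    by (simp add: e_def exp_cnj)
  have conte: "continuous_on A e" for A
    unfolding e_def by (intro continuous_intros)
  note cont2 = continuous_on_compose2[OF contg] continuous_on_compose2[OF conte[of UNIV]]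
  define f where "f x y = e x * (cnj (g y) * g (y + x))" for x y
  have "integrable lborel (\<lambda>(x, y). f x y)"
  proof (rule integrable_continuous_vanishing)
    show "continuous_on UNIV (\<lambda>(x, y). f x y)"
      unfolding f_def case_prod_unfold by (intro continuous_intros cont2) auto
    show "compact ({a - b..b - a} \<times> {a..b})"
      by (intro compact_Times compact_Icc)
    show "(case z of (x, y) \<Rightarrow> f x y) = 0" if "z \<notin> {a - b..b - a} \<times> {a..b}" for z
      using that g0[of "snd z"] g0[of "snd z + fst z"]
      by (cases "snd z \<in> {a..b}") (auto simp: f_def mem_Times_iff split: prod.split)
  qed
  then have int: "integrable (lborel \<Otimes>\<^sub>M lborel) (\<lambda>(x, y). f x y)"
    by (simp add: lborel_prod)
  have "fourier (autocorrelation g) t = (LINT x|lborel. LINT y|lborel. f x y)"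
    by (simp add: fourier_def autocorrelation_def f_def e_def)
  also have "\<dots> = (LINT y|lborel. LINT x|lborel. f x y)"
    using lborel_pair.Fubini_integral[OF int] by simp
  also have "\<dots> = (LINT y|lborel. cnj (e y * g y) * fourier g t)"
  proof (rule Bochner_Integration.integral_cong[OF refl])
    fix y
    have "(LINT x|lborel. f x y) = (LINT x|lborel. f (- y + 1 * x) y)"
      using lborel_integral_real_affine[of 1 "\<lambda>x. f x y" "- y"] by simp
    also have "\<dots> = (LINT x|lborel. cnj (e y * g y) * (e x * g x))"
      by (rule Bochner_Integration.integral_cong[OF refl])
         (simp add: f_def e_add e_cnj, simp add: e_def exp_minus exp_add field_simps flip: exp_add)
    also have "\<dots> = cnj (e y * g y) * fourier g t"
      by (simp add: fourier_def e_def)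
    finally show "(LINT x|lborel. f x y) = cnj (e y * g y) * fourier g t" .
  qed
  also have "\<dots> = cnj (fourier g t) * fourier g t"
  proof -
    have "cnj (LINT y|lborel. e y * g y) = (LINT y|lborel. cnj (e y * g y))"
      by (rule Bochner_Integration.integral_cnj[symmetric])
    moreover have "fourier g t = (LINT y|lborel. e y * g y)"
      by (simp add: fourier_def e_def)
    ultimately show ?thesis by simp
  qed
  also have "\<dots> = complex_of_real ((norm (fourier g t))\<^sup>2)"
    by (metis complex_norm_square mult.commute)
  finally show ?thesis .
qed

text \<open>(1 + t^2) times the transform of g is the transform of g - g'', hence bounded by the L1
  norm of g - g'' uniformly in t.\<close>

lemma fourier_smooth_decay:
  assumes "smooth_fun g" and g0: "\<And>x. x \<notin> {a..b} \<Longrightarrow> g x = 0" "a \<le> b"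
  obtains C where "\<And>t. norm (fourier g t) \<le> C / (1 + t\<^sup>2)"
proof -
  obtain g1 where g1: "smooth_fun g1" "\<And>x. (g has_vector_derivative g1 x) (at x)"
    using smooth_funE[OF assms(1)] by metis
  obtain g2 where g2: "smooth_fun g2" "\<And>x. (g1 has_vector_derivative g2 x) (at x)"
    using smooth_funE[OF g1(1)] by metis
  have g10: "g1 x = 0" if "x \<notin> {a..b}" for x
    using vector_derivative_outside_closed[OF g1(2) _ g0(1) that] by auto
  have g20: "g2 x = 0" if "x \<notin> {a..b}" for x
    using vector_derivative_outside_closed[OF g2(2) _ g10 that] by auto
  note cont = smooth_fun_continuous_on[OF assms(1)] smooth_fun_continuous_on[OF g2(1)]
  define C where "C = (LINT x|lborel. norm (g x - g2 x))"
  show ?thesis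
  proof
    fix t
    define e where "e x = exp (- \<i> * complex_of_real (t * x))" for x
    have conte: "continuous_on A e" for A
      unfolding e_def by (intro continuous_intros)
    have e': "(e has_vector_derivative (- \<i> * t) * e x) (at x)" for x
    proof -
      have "((\<lambda>z. exp (- \<i> * complex_of_real t * z)) has_field_derivative (- \<i> * t) * exp (- \<i> * t * complex_of_real x)) (at (complex_of_real x))"
        by (auto intro!: derivative_eq_intros)
      from has_vector_derivative_real_field[OF this] show ?thesis by (simp add: e_def[abs_def] mult.assoc)
    qed
    have int: "integrable lborel (\<lambda>x. e x * h x)"
      if "continuous_on UNIV h" "\<And>x. x \<notin> {a..b} \<Longrightarrow> h x = 0" for h
      by (rule integrable_continuous_vanishing[where K = "{a..b}"])
         (use that in \<open>auto intro!: continuous_intros conte\<close>)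
    \<comment> \<open>Both integrations by parts in one: \<open>w\<close> has derivative
      \<open>e x * (g2 x + t\<^sup>2 * g x)\<close>, so the integral of the latter is a boundary
      term.\<close>
    define w where "w x = e x * (g1 x + \<i> * t * g x)" for x
    have "(w has_vector_derivative e x * (g2 x + t\<^sup>2 * g x)) (at x)" for x
    proof -
      have "((\<lambda>x. g1 x + \<i> * t * g x) has_vector_derivative g2 x + \<i> * t * g1 x) (at x)"
        by (intro has_vector_derivative_add has_vector_derivative_mult_right g1 g2)
      from has_vector_derivative_mult[OF e' this] show ?thesis
        by (simp add: w_def[abs_def] algebra_simps power2_eq_square)
    qed
    \<comment> \<open>The interval is enlarged by 1 on each side so that its endpoints lie where
      \<open>g0\<close> and \<open>g10\<close> give the value 0.\<close>
    then have "((\<lambda>x. e x * (g2 x + t\<^sup>2 * g x)) has_integral (w (b + 1) - w (a - 1))) {a - 1..b + 1}"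
      using \<open>a \<le> b\<close> by (intro fundamental_theorem_of_calculus) (auto intro: has_vector_derivative_at_within)
    moreover have "w (b + 1) = 0" "w (a - 1) = 0"
      by (auto simp: w_def g0 g10)
    ultimately have "integral {a - 1..b + 1} (\<lambda>x. e x * (g2 x + t\<^sup>2 * g x)) = 0"
      by (simp add: integral_unique)
    moreover have "(LINT x|lborel. e x * (g2 x + t\<^sup>2 * g x)) = integral {a - 1..b + 1} (\<lambda>x. e x * (g2 x + t\<^sup>2 * g x))"
      by (rule integral_lborel_interval) (auto intro!: continuous_intros conte cont simp: g0 g20)
    ultimately have 0: "(LINT x|lborel. e x * (g2 x + t\<^sup>2 * g x)) = 0" by simp
    have "complex_of_real (1 + t\<^sup>2) * fourier g t = (LINT x|lborel. complex_of_real (1 + t\<^sup>2) * (e x * g x))"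
      by (simp add: fourier_def e_def)
    also have "\<dots> = (LINT x|lborel. e x * (g x - g2 x) + e x * (g2 x + t\<^sup>2 * g x))"
      by (rule Bochner_Integration.integral_cong) (auto simp: algebra_simps)
    also have "\<dots> = (LINT x|lborel. e x * (g x - g2 x)) + (LINT x|lborel. e x * (g2 x + t\<^sup>2 * g x))"
      by (intro Bochner_Integration.integral_add int continuous_intros cont) (auto simp: g0 g20)
    finally have "complex_of_real (1 + t\<^sup>2) * fourier g t = (LINT x|lborel. e x * (g x - g2 x))"
      using 0 by simp
    then have "norm (complex_of_real (1 + t\<^sup>2) * fourier g t) \<le> (LINT x|lborel. norm (e x * (g x - g2 x)))"
      by (metis integral_norm_bound)
    also have "\<dots> = C" by (simp add: C_def norm_mult e_def)
    finally have "(1 + t\<^sup>2) * norm (fourier g t) \<le> C"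
      by (simp add: norm_mult del: of_real_add)
    then show "norm (fourier g t) \<le> C / (1 + t\<^sup>2)"
      by (simp add: field_simps add_pos_nonneg)
  qed
qed

lemma borel_measurable_fourier:
  assumes "continuous_on UNIV g"
  shows "fourier g \<in> borel_measurable borel"
proof -
  have [measurable]: "g \<in> borel_measurable borel"
    by (rule borel_measurable_continuous_onI[OF assms])
  show ?thesis unfolding fourier_def by measurable
qed

text \<open>The minus sign fits \<open>ft_inv_pair\<close>. The decay of order four, the square of
  the quadratic decay of the bump's transform, leaves room for a weight 1 + |t|;
  \<open>\<psi> 0\<close> is the squared integral of the bump.\<close>

lemma positive_kernel_exists:
  assumes "\<delta> > 0"
  obtains \<phi> \<psi> C where "smooth_fun \<phi>" "\<And>x. \<bar>x\<bar> > \<delta> \<Longrightarrow> \<phi> x = 0"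
    "\<And>t. fourier \<phi> (- t) = complex_of_real (\<psi> t)" "\<And>t. \<psi> t \<ge> 0" "\<psi> 0 > 0"
    "\<And>t. \<psi> t \<le> C / (1 + t\<^sup>2)\<^sup>2" "\<psi> \<in> borel_measurable borel"
proof -
  obtain \<beta> where \<beta>: "smooth_fun (\<lambda>x. complex_of_real (\<beta> x))"
    "\<And>x. \<beta> x \<ge> 0" "\<And>x. x \<notin> {0..\<delta>} \<Longrightarrow> \<beta> x = 0" "\<And>x. x \<in> {0<..<\<delta>} \<Longrightarrow> \<beta> x > 0"
    using smooth_bump_exists[OF assms] by metis
  define g where "g x = complex_of_real (\<beta> x)" for x
  have g: "smooth_fun g" "\<And>x. x \<notin> {0..\<delta>} \<Longrightarrow> g x = 0"
    using \<beta> by (auto simp: g_def[abs_def])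
  have cont: "continuous_on UNIV g" using smooth_fun_continuous_on[OF g(1)] .
  obtain C where C: "\<And>t. norm (fourier g t) \<le> C / (1 + t\<^sup>2)"
    using fourier_smooth_decay[OF g less_imp_le[OF assms]] by blast
  define \<psi> where "\<psi> t = (norm (fourier g (- t)))\<^sup>2" for t
  show ?thesis
  proof (rule that[of "autocorrelation g" \<psi> "C\<^sup>2"])
    show "smooth_fun (autocorrelation g)" by (rule smooth_fun_autocorrelation[OF g])
    show "autocorrelation g x = 0" if "\<bar>x\<bar> > \<delta>" for x
      by (rule autocorrelation_eq_0[OF g(2)]) (use that in auto)
    show "fourier (autocorrelation g) (- t) = complex_of_real (\<psi> t)" for t
      unfolding \<psi>_def by (rule fourier_autocorrelation[OF cont g(2)])
    show "\<psi> t \<ge> 0" for t by (simp add: \<psi>_def)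
    show "\<psi> t \<le> C\<^sup>2 / (1 + t\<^sup>2)\<^sup>2" for t
      unfolding \<psi>_def power_divide[symmetric] using C[of "- t"] by (intro power_mono) auto
    have "(\<lambda>t. fourier g (- t)) \<in> borel_measurable borel"
      using borel_measurable_fourier[OF cont] by measurable
    then show "\<psi> \<in> borel_measurable borel" unfolding \<psi>_def by measurable
    have int: "integrable lborel \<beta>"
      by (rule integrable_continuous_vanishing[where K = "{0..\<delta>}"])
         (use \<beta>(3) continuous_on_Re[OF cont] in \<open>auto simp: g_def\<close>)
    have "(LINT x|lborel. \<beta> x) \<noteq> 0"
    proof
      assume "(LINT x|lborel. \<beta> x) = 0"
      then have "AE x in lborel. \<beta> x = 0"
        using integral_nonneg_eq_0_iff_AE[OF int] \<beta>(2) by simp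
      then have "AE x in lborel. x \<notin> {0<..<\<delta>}"
        by eventually_elim (use \<beta>(4) in force)
      then have "emeasure lborel {0<..<\<delta>} = 0"
        by (subst (asm) AE_iff_measurable[where N = "{0<..<\<delta>}"]) auto
      with assms show False by simp
    qed
    moreover have "fourier g 0 = complex_of_real (LINT x|lborel. \<beta> x)"
      by (simp add: fourier_def g_def)
    ultimately show "\<psi> 0 > 0" by (simp add: \<psi>_def)
  qed
qed

section \<open>A Tauberian theorem for sequences indexed by the integers\<close>

text \<open>Strictly a correlation: with j = m + k the kernel is evaluated at j - m, the form psi(N
  - n) in which the boundary values arrive.\<close>

definition conv_int :: "(int \<Rightarrow> real) \<Rightarrow> (int \<Rightarrow> real) \<Rightarrow> int \<Rightarrow> real" where
  "conv_int p s m = (\<Sum>\<^sub>\<infinity>k. s (m + k) * p k)"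

text \<open>Measures what a sequence of linear growth about the centre can contribute from distance
  more than h.\<close>

definition moment_tail :: "(int \<Rightarrow> real) \<Rightarrow> int \<Rightarrow> real" where
  "moment_tail p h = (\<Sum>\<^sub>\<infinity>k\<in>{k. \<bar>k\<bar> > h}. (1 + \<bar>real_of_int k\<bar>) * p k)"

text \<open>\<open>moment\<close> makes convolutions with linearly growing sequences converge;
  \<open>pos\<close> is what detects a large value, since a window enters the estimates only through
  its central term.\<close>

locale positive_kernel =
  fixes p :: "int \<Rightarrow> real"
  assumes nonneg: "p k \<ge> 0"
    and moment: "(\<lambda>k. (1 + \<bar>real_of_int k\<bar>) * p k) summable_on UNIV"
    and pos: "p 0 > 0"
begin

lemma moment_summable_on: "(\<lambda>k. (1 + \<bar>real_of_int k\<bar>) * p k) summable_on A"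
  by (rule summable_on_subset_banach[OF moment]) simp

lemma moment_tail_small:
  assumes "\<epsilon> > 0"
  obtains h0 where "h0 \<ge> 0" "\<And>h. h \<ge> h0 \<Longrightarrow> moment_tail p h \<le> \<epsilon>"
proof -
  let ?w = "\<lambda>k. (1 + \<bar>real_of_int k\<bar>) * p k"
  have w0: "?w k \<ge> 0" for k using nonneg[of k] by simp
  obtain F where F: "finite F" "dist (sum ?w F) (infsum ?w UNIV) \<le> \<epsilon>"
    using infsum_finite_approximation[OF moment assms] by auto
  obtain h0 where h0: "\<And>k. k \<in> F \<Longrightarrow> \<bar>k\<bar> \<le> h0" "h0 \<ge> 0"
  proof
    show "\<bar>k\<bar> \<le> Max (insert 0 (abs ` F))" if "k \<in> F" for k using that F(1) by (intro Max_ge) simp_all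
    show "0 \<le> Max (insert 0 (abs ` F))" using F(1) by (intro Max_ge) auto
  qed
  show ?thesis
  proof
    fix h assume "h \<ge> h0"
    have disj: "{k. \<bar>k\<bar> > h} \<inter> F = {}"
    proof (intro equals0I)
      fix k assume "k \<in> {k. \<bar>k\<bar> > h} \<inter> F"
      then show False using h0(1)[of k] \<open>h \<ge> h0\<close> by simp
    qed
    have "moment_tail p h + sum ?w F = infsum ?w ({k. \<bar>k\<bar> > h} \<union> F)"
      unfolding moment_tail_def
      using infsum_Un_disjoint[OF moment_summable_on moment_summable_on disj] F(1) by simp
    also have "\<dots> \<le> infsum ?w UNIV"
      by (rule infsum_mono_neutral) (use w0 in \<open>simp_all add: moment_summable_on\<close>)
    finally show "moment_tail p h \<le> \<epsilon>"
      using F(2) by (simp add: dist_real_def)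
  qed fact
qed

lemma conv_summable:
  fixes s :: "int \<Rightarrow> real" and A :: real
  assumes "\<And>j. \<bar>s j\<bar> \<le> A * (1 + \<bar>real_of_int j\<bar>)"
  shows "(\<lambda>k. s (m + k) * p k) summable_on UNIV"
proof -
  have "(\<lambda>k. norm ((A * (1 + \<bar>real_of_int m\<bar>)) * ((1 + \<bar>real_of_int k\<bar>) * p k))) summable_on UNIV"
    by (rule summable_on_iff_abs_summable_on_real[THEN iffD1]) (rule summable_on_cmult_right[OF moment])
  then have "(\<lambda>k. norm (s (m + k) * p k)) summable_on UNIV"
  proof (rule Infinite_Sum.abs_summable_on_comparison_test)
    fix k
    have "A \<ge> 0" using assms[of 0] by simp
    have "\<bar>s (m + k)\<bar> \<le> A * (1 + \<bar>real_of_int (m + k)\<bar>)" by (rule assms)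
    also have "\<dots> \<le> A * ((1 + \<bar>real_of_int m\<bar>) * (1 + \<bar>real_of_int k\<bar>))"
    proof (rule mult_left_mono[OF _ \<open>A \<ge> 0\<close>])
      have "0 \<le> \<bar>real_of_int m\<bar> * \<bar>real_of_int k\<bar>" by simp
      moreover have "\<bar>real_of_int (m + k)\<bar> \<le> \<bar>real_of_int m\<bar> + \<bar>real_of_int k\<bar>" by simp
      ultimately show "1 + \<bar>real_of_int (m + k)\<bar> \<le> (1 + \<bar>real_of_int m\<bar>) * (1 + \<bar>real_of_int k\<bar>)"
        by (simp only: distrib_left distrib_right)
    qed
    finally have "\<bar>s (m + k)\<bar> \<le> A * (1 + \<bar>real_of_int m\<bar>) * (1 + \<bar>real_of_int k\<bar>)" by (simp add: mult.assoc)
    then have "\<bar>s (m + k)\<bar> * p k \<le> A * (1 + \<bar>real_of_int m\<bar>) * (1 + \<bar>real_of_int k\<bar>) * p k"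
      by (rule mult_right_mono) (rule nonneg)
    also have "\<dots> = norm ((A * (1 + \<bar>real_of_int m\<bar>)) * ((1 + \<bar>real_of_int k\<bar>) * p k))"
      using nonneg[of k] \<open>A \<ge> 0\<close> by (simp add: abs_mult mult.assoc)
    finally show "norm (s (m + k) * p k) \<le> norm ((A * (1 + \<bar>real_of_int m\<bar>)) * ((1 + \<bar>real_of_int k\<bar>) * p k))"
      using nonneg[of k] by (simp add: abs_mult)
  qed
  then show ?thesis by (rule summable_on_iff_abs_summable_on_real[THEN iffD2])
qed

text \<open>Inside the window all terms are non-negative, so all but k = 0 may be dropped; outside,
  the linear bound centred at m costs at most K times the moment tail.\<close>

lemma conv_lower_bound:
  fixes s :: "int \<Rightarrow> real" and \<kappa> K :: real
  assumes sum: "(\<lambda>k. s (m + k) * p k) summable_on UNIV"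
    and \<kappa>: "\<kappa> \<ge> 0" "\<And>j. \<bar>j - m\<bar> \<le> h \<Longrightarrow> s j \<ge> \<kappa>"
    and K: "\<And>j. \<bar>j - m\<bar> > h \<Longrightarrow> \<bar>s j\<bar> \<le> K * (1 + \<bar>real_of_int (j - m)\<bar>)"
    and h: "h \<ge> 0"
  shows "\<kappa> * p 0 - K * moment_tail p h \<le> conv_int p s m"
proof -
  let ?w = "\<lambda>k. (1 + \<bar>real_of_int k\<bar>) * p k"
  have "((\<lambda>k::int. \<kappa> * (if k = 0 then p 0 else 0)) has_sum \<kappa> * p 0) UNIV"
  proof (intro has_sum_cmult_right)
    have "(p has_sum p 0) {0}" using has_sum_finite[of "{0}" p] by simp
    moreover have "((\<lambda>k::int. if k = 0 then p 0 else 0) has_sum p 0) UNIV \<longleftrightarrow> (p has_sum p 0) {0}"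
      by (rule has_sum_cong_neutral) auto
    ultimately show "((\<lambda>k::int. if k = 0 then p 0 else 0) has_sum p 0) UNIV" by simp
  qed
  moreover have "((\<lambda>k. K * (if \<bar>k\<bar> > h then ?w k else 0)) has_sum K * moment_tail p h) UNIV"
  proof (intro has_sum_cmult_right)
    have "(?w has_sum moment_tail p h) {k. \<bar>k\<bar> > h}"
      unfolding moment_tail_def using moment_summable_on by (rule has_sum_infsum)
    then show "((\<lambda>k. if \<bar>k\<bar> > h then ?w k else 0) has_sum moment_tail p h) UNIV"
      by (subst has_sum_cong_neutral[where T = "{k. \<bar>k\<bar> > h}" and g = ?w]) auto
  qed
  ultimately have low: "((\<lambda>k::int. \<kappa> * (if k = 0 then p 0 else 0) + - (K * (if \<bar>k\<bar> > h then ?w k else 0)))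
      has_sum \<kappa> * p 0 + - (K * moment_tail p h)) UNIV"
    by (intro has_sum_add) (simp_all add: has_sum_uminus)
  have "((\<lambda>k. s (m + k) * p k) has_sum conv_int p s m) UNIV"
    unfolding conv_int_def using sum by (rule has_sum_infsum)
  moreover have "\<kappa> * (if k = 0 then p 0 else 0) + - (K * (if \<bar>k\<bar> > h then ?w k else 0)) \<le> s (m + k) * p k" for k
  proof (cases "\<bar>k\<bar> > h")
    case True
    then have "\<bar>s (m + k)\<bar> * p k \<le> K * (1 + \<bar>real_of_int k\<bar>) * p k"
      using K[of "m + k"] nonneg[of k] by (intro mult_right_mono) auto
    moreover have "- (\<bar>s (m + k)\<bar> * p k) \<le> s (m + k) * p k"
      using mult_right_mono[of "- \<bar>s (m + k)\<bar>" "s (m + k)" "p k"] nonneg[of k] by auto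
    ultimately show ?thesis using True h by (auto simp: mult.assoc)
  next
    case False
    then have "\<kappa> * p k \<le> s (m + k) * p k"
      using \<kappa>(2)[of "m + k"] nonneg[of k] by (intro mult_right_mono) auto
    moreover have "\<kappa> * p k \<ge> 0" using \<kappa>(1) nonneg[of k] by simp
    ultimately show ?thesis using False by auto
  qed
  ultimately have "\<kappa> * p 0 + - (K * moment_tail p h) \<le> conv_int p s m"
    using has_sum_mono[OF low] by blast
  then show ?thesis by simp
qed

lemma conv_uminus: "conv_int p (\<lambda>j. - s j) m = - conv_int p s m"
  by (simp add: conv_int_def infsum_uminus)

text \<open>A slowly decreasing sequence keeps at least half of its value on a one-sided window, to the
  right of n if it is positive there and to the left if it is negative.\<close>
lemma window_bound:
  fixes s :: "int \<Rightarrow> real" and b K :: real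
  assumes sum: "\<And>m. (\<lambda>k. s (m + k) * p k) summable_on UNIV"
    and slow: "\<And>i j. n - 2 * h \<le> i \<Longrightarrow> i \<le> j \<Longrightarrow> j \<le> n + 2 * h \<Longrightarrow> s i - b * (j - i) \<le> s j"
    and K: "\<And>m j. m \<in> {n - h, n + h} \<Longrightarrow> \<bar>j - m\<bar> > h \<Longrightarrow> \<bar>s j\<bar> \<le> K * (1 + \<bar>real_of_int (j - m)\<bar>)"
    and h: "h \<ge> 0" and b: "b \<ge> 0" "4 * b * h \<le> \<bar>s n\<bar>"
  shows "\<exists>m\<in>{n - h, n + h}. \<bar>s n\<bar> / 2 * p 0 - K * moment_tail p h \<le> \<bar>conv_int p s m\<bar>"
proof (cases "s n \<ge> 0")
  case True
  \<comment> \<open>The window of radius h about n + h is [n, n + 2 h]. Slow decrease loses at most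
    2 b h <= |s n| / 2 across it, whence the factor 4 in the hypothesis on b.\<close>
  have "\<bar>s n\<bar> / 2 * p 0 - K * moment_tail p h \<le> conv_int p s (n + h)"
  proof (rule conv_lower_bound[OF sum])
    fix j assume j: "\<bar>j - (n + h)\<bar> \<le> h"
    have "b * (j - n) \<le> b * (2 * h)" using j b by (intro mult_left_mono) auto
    moreover have "s n - b * (j - n) \<le> s j" using j h by (intro slow) auto
    ultimately show "\<bar>s n\<bar> / 2 \<le> s j" using b(2) True by simp
  qed (use K[of "n + h"] h in auto)
  then show ?thesis by auto
next
  case False
  \<comment> \<open>Mirror image: slow decrease read from j up to n bounds s j from above, so the
    window [n - 2 h, n] is used for -s.\<close>
  have "\<bar>s n\<bar> / 2 * p 0 - K * moment_tail p h \<le> conv_int p (\<lambda>j. - s j) (n - h)"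
  proof (rule conv_lower_bound)
    show "(\<lambda>k. - s (n - h + k) * p k) summable_on UNIV"
      using sum[of "n - h"] by (simp add: summable_on_uminus)
    fix j assume j: "\<bar>j - (n - h)\<bar> \<le> h"
    have "b * (n - j) \<le> b * (2 * h)" using j b by (intro mult_left_mono) auto
    moreover have "s j - b * (n - j) \<le> s n" using j h by (intro slow) auto
    ultimately show "\<bar>s n\<bar> / 2 \<le> - s j" using b(2) False by simp
  qed (use K[of "n - h"] h in auto)
  then show ?thesis by (auto simp: conv_uminus)
qed

section \<open>Slowly decreasing sequences: boundedness, then the limit 0\<close>

text \<open>The core is \<open>near_max\<close>: where |s j| is controlled by |s n| around n and |s
  n| is not small, a window of radius about |s n| / (4 B) is available, and some convolution value
  there is at least |s n| p 0 / 4 in modulus.\<close>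

lemma slowly_decreasing_conv_bounded:
  fixes s :: "int \<Rightarrow> real" and A B M :: real
  assumes growth: "\<And>j. \<bar>s j\<bar> \<le> A * (1 + \<bar>real_of_int j\<bar>)"
    and slow: "\<And>i j. i \<le> j \<Longrightarrow> s i - B * (j - i) \<le> s j" and B: "B > 0"
    and M: "\<And>m. \<bar>conv_int p s m\<bar> \<le> M"
  obtains R where "\<And>j. \<bar>s j\<bar> \<le> R"
proof -
  have sum: "(\<lambda>k. s (m + k) * p k) summable_on UNIV" for m
    by (rule conv_summable[OF growth])
  \<comment> \<open>The tail will carry the constant 4 |s n|; with 1/16 it takes at most |s n| p 0 /
    4, half of the window's |s n| p 0 / 2.\<close>
  obtain h0 where h0: "h0 \<ge> 0" "\<And>h. h \<ge> h0 \<Longrightarrow> moment_tail p h \<le> p 0 / 16"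
    using moment_tail_small[of "p 0 / 16"] pos by auto
  \<comment> \<open>Above the first entry the radius, the floor of |s n| / (4 B), is at least
    \<open>h0\<close>; the second entry is what |s n| p 0 / 4 <= M gives.\<close>
  define R where "R = max (4 * B * (h0 + 1)) (4 * M / p 0)"
  have "R \<ge> 0" using B h0(1) by (simp add: R_def le_max_iff_disj)
  have near_max: "\<bar>s n\<bar> \<le> R" if n: "\<And>j. \<bar>s j\<bar> \<le> 2 * \<bar>s n\<bar> * (1 + \<bar>real_of_int (j - n)\<bar>)" for n
  proof (cases "\<bar>s n\<bar> < 4 * B * (h0 + 1)")
    case False
    define h where "h = \<lfloor>\<bar>s n\<bar> / (4 * B)\<rfloor>"
    have "h0 \<le> h" using False B by (simp add: h_def le_floor_iff field_simps)
    have "real_of_int h \<le> \<bar>s n\<bar> / (4 * B)" by (simp add: h_def)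
    then have h4: "4 * B * h \<le> \<bar>s n\<bar>" using B by (simp add: field_simps)
    have "\<exists>m\<in>{n - h, n + h}. \<bar>s n\<bar> / 2 * p 0 - (4 * \<bar>s n\<bar>) * moment_tail p h \<le> \<bar>conv_int p s m\<bar>"
    proof (rule window_bound[OF sum])
      \<comment> \<open>Recentring from n to m = n - h or n + h at most doubles the distance,
        because h < |j - m|; this turns 2 |s n| into 4 |s n|.\<close>
      fix m j assume mj: "m \<in> {n - h, n + h}" "\<bar>j - m\<bar> > h"
      then have "\<bar>j - n\<bar> \<le> 2 * \<bar>j - m\<bar>"
      proof -
        have "\<bar>m - n\<bar> \<le> \<bar>j - m\<bar>" using mj h0(1) \<open>h0 \<le> h\<close> by auto
        moreover have "\<bar>j - n\<bar> \<le> \<bar>j - m\<bar> + \<bar>m - n\<bar>" by linarith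
        ultimately show ?thesis by simp
      qed
      then have "real_of_int \<bar>j - n\<bar> \<le> real_of_int (2 * \<bar>j - m\<bar>)"
        by (simp only: of_int_le_iff)
      then have "\<bar>s n\<bar> * (1 + \<bar>real_of_int (j - n)\<bar>) \<le> \<bar>s n\<bar> * (2 * (1 + \<bar>real_of_int (j - m)\<bar>))"
        by (intro mult_left_mono) auto
      with n[of j] show "\<bar>s j\<bar> \<le> 4 * \<bar>s n\<bar> * (1 + \<bar>real_of_int (j - m)\<bar>)"
        by (simp add: distrib_left)
    qed (use slow B h4 h0(1) \<open>h0 \<le> h\<close> in auto)
    then have "\<bar>s n\<bar> / 2 * p 0 - (4 * \<bar>s n\<bar>) * moment_tail p h \<le> M"
      using M by (meson order_trans)
    moreover have "(4 * \<bar>s n\<bar>) * moment_tail p h \<le> (4 * \<bar>s n\<bar>) * (p 0 / 16)"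
      using h0(2)[OF \<open>h0 \<le> h\<close>] by (intro mult_left_mono) auto
    ultimately have "\<bar>s n\<bar> * p 0 \<le> 4 * M" by (simp add: algebra_simps)
    then show ?thesis using pos by (simp add: R_def field_simps le_max_iff_disj)
  qed (simp add: R_def)
  text \<open>The weights make the supremum finite; their ratio at j and n is at most
    \<open>1 + \<bar>j - n\<bar>\<close>, so a near-maximiser of the weighted sequence satisfies the hypothesis of the
    previous claim, whose bound does not depend on the weight.\<close>
  have weighted: "\<bar>s j\<bar> \<le> 2 * R * (1 + \<delta> * \<bar>real_of_int j\<bar>)" if \<delta>: "0 < \<delta>" "\<delta> \<le> 1" for \<delta> :: real and j
  proof -
    define q where "q j = \<bar>s j\<bar> / (1 + \<delta> * \<bar>real_of_int j\<bar>)" for j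
    have w: "1 + \<delta> * \<bar>real_of_int j\<bar> > 0" for j using \<delta> by (simp add: add_pos_nonneg)
    have "A \<ge> 0" using growth[of 0] by simp
    have "q j \<le> A / \<delta>" for j
    proof -
      have "\<bar>s j\<bar> * \<delta> \<le> (A * (1 + \<bar>real_of_int j\<bar>)) * \<delta>" using growth[of j] \<delta> by (intro mult_right_mono) auto
      also have "\<dots> = A * (\<delta> + \<delta> * \<bar>j\<bar>)" by (simp add: algebra_simps)
      also have "\<dots> \<le> A * (1 + \<delta> * \<bar>real_of_int j\<bar>)" using \<delta> \<open>A \<ge> 0\<close> by (intro mult_left_mono) auto
      finally show ?thesis using \<delta> w[of j] by (simp add: q_def field_simps)
    qed
    then have bdd: "bdd_above (range q)" by (intro bdd_aboveI2)
    define S where "S = Sup (range q)"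
    have qS: "q j \<le> S" for j unfolding S_def using bdd by (simp add: cSup_upper)
    have "q j \<le> 2 * R" for j
    proof (cases "S = 0")
      case True
      then show ?thesis using qS[of j] \<open>R \<ge> 0\<close> by simp
    next
      case False
      have "q 0 \<ge> 0" by (simp add: q_def)
      then have "S > 0" using qS[of 0] False by linarith
      then have "\<exists>x\<in>range q. S / 2 < x"
        by (intro less_cSupD) (auto simp: S_def[symmetric])
      then obtain n where n: "S / 2 < q n" by auto
      then have n': "S * (1 + \<delta> * \<bar>real_of_int n\<bar>) \<le> 2 * \<bar>s n\<bar>"
        using w[of n] by (simp add: q_def field_simps)
      have "\<bar>s n\<bar> \<le> R"
      proof (rule near_max)
        fix j
        have "\<bar>s j\<bar> \<le> S * (1 + \<delta> * \<bar>real_of_int j\<bar>)" using qS[of j] w[of j] by (simp add: q_def field_simps)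
        also have "\<dots> \<le> S * ((1 + \<delta> * \<bar>real_of_int n\<bar>) * (1 + \<bar>real_of_int (j - n)\<bar>))"
        proof (rule mult_left_mono)
          have "\<delta> * \<bar>real_of_int j\<bar> \<le> \<delta> * (\<bar>real_of_int n\<bar> + \<bar>real_of_int (j - n)\<bar>)"
            using \<delta> by (intro mult_left_mono) auto
          also have "\<dots> \<le> \<delta> * \<bar>real_of_int n\<bar> + 1 * \<bar>real_of_int (j - n)\<bar>"
            using \<delta> mult_right_mono[of \<delta> 1 "\<bar>real_of_int (j - n)\<bar>"] by (simp add: distrib_left)
          finally have "1 + \<delta> * \<bar>real_of_int j\<bar> \<le> 1 + \<delta> * \<bar>real_of_int n\<bar> + \<bar>real_of_int (j - n)\<bar>" by simp
          also have "\<dots> \<le> (1 + \<delta> * \<bar>real_of_int n\<bar>) * (1 + \<bar>real_of_int (j - n)\<bar>)"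
            using \<delta> by (simp add: algebra_simps)
          finally show "1 + \<delta> * \<bar>real_of_int j\<bar> \<le> (1 + \<delta> * \<bar>real_of_int n\<bar>) * (1 + \<bar>real_of_int (j - n)\<bar>)"
            by simp
        qed (use \<open>S > 0\<close> in auto)
        also have "\<dots> \<le> 2 * \<bar>s n\<bar> * (1 + \<bar>real_of_int (j - n)\<bar>)"
          unfolding mult.assoc[symmetric] using n' by (intro mult_right_mono) auto
        finally show "\<bar>s j\<bar> \<le> 2 * \<bar>s n\<bar> * (1 + \<bar>real_of_int (j - n)\<bar>)" .
      qed
      \<comment> \<open>The weights are at least 1, so S < 2 q n <= 2 |s n| <= 2 R, a bound free of
        \<delta>.\<close>
      moreover have "q n \<le> \<bar>s n\<bar>"
        using w[of n] \<delta> by (simp add: q_def divide_le_eq mult_le_cancel_left1)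
      ultimately show ?thesis using qS[of j] n by linarith
    qed
    from this[of j] show ?thesis using w[of j] by (simp add: q_def pos_divide_le_eq)
  qed
  have *: "\<bar>s j\<bar> \<le> 2 * R + \<delta> * (2 * R * \<bar>real_of_int j\<bar>)" if "0 < \<delta>" "\<delta> \<le> 1" for \<delta> :: real and j
    using weighted[OF that, of j] by (simp add: algebra_simps)
  \<comment> \<open>For fixed j the weight tends to 1 as \<delta> -> 0.\<close>
  have "\<bar>s j\<bar> \<le> 2 * R" for j
  proof (rule tendsto_lowerbound)
    have "((\<lambda>\<delta>. 2 * R + \<delta> * (2 * R * \<bar>real_of_int j\<bar>)) \<longlongrightarrow> 2 * R + 0 * (2 * R * \<bar>real_of_int j\<bar>)) (at_right 0)"
      by (intro tendsto_intros)
    then show "((\<lambda>\<delta>. 2 * R + \<delta> * (2 * R * \<bar>real_of_int j\<bar>)) \<longlongrightarrow> 2 * R) (at_right 0)" by simp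
    show "\<forall>\<^sub>F \<delta> in at_right 0. \<bar>s j\<bar> \<le> 2 * R + \<delta> * (2 * R * \<bar>real_of_int j\<bar>)"
      by (rule eventually_at_rightI[of 0 1]) (use * in auto)
  qed auto
  then show ?thesis using that by blast
qed

text \<open>Boundedness makes the far-term constant K the same at every index, so h and then b are
  chosen independently of n; |s n| >= e would force a convolution value of at least 3 e p 0 / 8 in
  modulus at n - h or n + h.\<close>

lemma slowly_decreasing_conv_tendsto_0:
  fixes s :: "int \<Rightarrow> real" and K :: real
  assumes K: "\<And>j. \<bar>s j\<bar> \<le> K"
    and slow: "\<And>\<epsilon>. (\<epsilon> :: real) > 0 \<Longrightarrow> \<exists>N. \<forall>i j. N \<le> i \<longrightarrow> i \<le> j \<longrightarrow> s i - \<epsilon> * (j - i) \<le> s j"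
    and lim: "(conv_int p s \<longlongrightarrow> 0) at_top"
  shows "(s \<longlongrightarrow> 0) at_top"
proof (rule tendstoI)
  fix e :: real assume "e > 0"
  have "K \<ge> 0" using K[of 0] by linarith
  have K': "\<bar>s j\<bar> \<le> K * (1 + \<bar>real_of_int i\<bar>)" for i j :: int
    using K[of j] \<open>K \<ge> 0\<close> mult_left_mono[of 1 "1 + \<bar>real_of_int i\<bar>" K] by simp
  have sum: "(\<lambda>k. s (m + k) * p k) summable_on UNIV" for m
    by (rule conv_summable[OF K'])
  \<comment> \<open>K + 1 rather than K, so that K = 0 causes no division by zero.\<close>
  have \<epsilon>pos: "e * p 0 / (8 * (K + 1)) > 0" using pos \<open>e > 0\<close> \<open>K \<ge> 0\<close> by simp
  obtain h where h: "h \<ge> 0" "moment_tail p h \<le> e * p 0 / (8 * (K + 1))"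
    using moment_tail_small[OF \<epsilon>pos] by (metis order_refl)
  have Kt: "K * moment_tail p h \<le> e * p 0 / 8"
  proof -
    have "K * moment_tail p h \<le> K * (e * p 0 / (8 * (K + 1)))"
      using h(2) \<open>K \<ge> 0\<close> by (rule mult_left_mono)
    also have "\<dots> \<le> e * p 0 / 8" using \<open>K \<ge> 0\<close> \<open>e > 0\<close> pos by (simp add: field_simps)
    finally show ?thesis .
  qed
  \<comment> \<open>The descent across a window of length 2 h is then at most e / 2; the added 1
    covers h = 0.\<close>
  define b where "b = e / (4 * h + 1)"
  have b: "b > 0" "4 * b * h \<le> e" using h(1) \<open>e > 0\<close> by (auto simp: b_def field_simps)
  obtain N where N: "\<And>i j. N \<le> i \<Longrightarrow> i \<le> j \<Longrightarrow> s i - b * (j - i) \<le> s j"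
    using slow[OF b(1)] by blast
  have "\<forall>\<^sub>F m in at_top. \<bar>conv_int p s m\<bar> < e * p 0 / 8"
    using tendstoD[OF lim, of "e * p 0 / 8"] \<open>e > 0\<close> pos by (simp add: dist_real_def)
  then obtain N' where N': "\<And>m. m \<ge> N' \<Longrightarrow> \<bar>conv_int p s m\<bar> < e * p 0 / 8"
    by (auto simp: eventually_at_top_linorder)
  show "\<forall>\<^sub>F n in at_top. dist (s n) 0 < e"
    unfolding eventually_at_top_linorder
  \<comment> \<open>Slow decrease has to hold from n - 2 h on, and the convolution has to be small
    already at n - h.\<close>
  proof (intro exI[of _ "max N N' + 2 * h"] allI impI)
    fix n assume n: "max N N' + 2 * h \<le> n"
    show "dist (s n) 0 < e"
    proof (rule ccontr)
      assume "\<not> dist (s n) 0 < e"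
      then have e: "e \<le> \<bar>s n\<bar>" by (simp add: dist_real_def)
      have "\<exists>m\<in>{n - h, n + h}. \<bar>s n\<bar> / 2 * p 0 - K * moment_tail p h \<le> \<bar>conv_int p s m\<bar>"
      proof (rule window_bound[OF sum _ K' h(1)])
        show "s i - b * (j - i) \<le> s j" if "n - 2 * h \<le> i" "i \<le> j" for i j
          using that n by (intro N) auto
        show "b \<ge> 0" "4 * b * h \<le> \<bar>s n\<bar>" using b e by linarith+
      qed
      then obtain m where m: "m \<in> {n - h, n + h}" "\<bar>s n\<bar> / 2 * p 0 - K * moment_tail p h \<le> \<bar>conv_int p s m\<bar>" by blast
      have "m \<ge> N'" using m(1) n h by auto
      moreover have "e / 2 * p 0 \<le> \<bar>s n\<bar> / 2 * p 0" using e pos by (intro mult_right_mono) auto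
      moreover have "e * p 0 > 0" using \<open>e > 0\<close> pos by simp
      ultimately show False using N'[of m] m(2) Kt by linarith
    qed
  qed
qed

end

section \<open>From Abel means to convolutions\<close>

text \<open>Each partial sum is the limit of truncated Abel sums and hence at most l; conversely no
  Abel sum exceeds the full sum.\<close>

lemma sums_of_tendsto_Abel_nonneg:
  fixes v :: "nat \<Rightarrow> real"
  assumes nonneg: "\<And>N. v N \<ge> 0"
    and summable: "\<And>r. 0 < r \<Longrightarrow> r < 1 \<Longrightarrow> summable (\<lambda>N. v N * r ^ N)"
    and lim: "((\<lambda>r. \<Sum>N. v N * r ^ N) \<longlongrightarrow> l) (at_left 1)"
  shows "v sums l"
proof -
  have ev: "\<forall>\<^sub>F r in at_left (1::real). 0 < r \<and> r < 1"
    by (rule eventually_at_leftI[of 0]) auto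
  have partial: "sum v {..<M} \<le> l" for M
  proof (rule tendsto_le[OF _ lim])
    show "((\<lambda>r. \<Sum>N<M. v N * r ^ N) \<longlongrightarrow> sum v {..<M}) (at_left 1)"
      by (auto intro!: tendsto_eq_intros)
    show "\<forall>\<^sub>F r in at_left 1. (\<Sum>N<M. v N * r ^ N) \<le> (\<Sum>N. v N * r ^ N)"
      using ev by eventually_elim (auto intro!: sum_le_suminf summable nonneg mult_nonneg_nonneg)
  qed simp
  have sv: "summable v"
    by (rule summableI_nonneg_bounded[OF nonneg partial])
  have "suminf v \<le> l" by (rule suminf_le_const[OF sv partial])
  moreover have "l \<le> suminf v"
  proof (rule tendsto_upperbound[OF lim])
    show "\<forall>\<^sub>F r in at_left 1. (\<Sum>N. v N * r ^ N) \<le> suminf v"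
      using ev
    proof eventually_elim
      case (elim r)
      then have "v N * r ^ N \<le> v N" for N
        using nonneg[of N] by (simp add: mult_left_le power_le_one)
      then show ?case using elim by (intro suminf_le summable sv) auto
    qed
  qed simp
  ultimately show ?thesis using sv by (simp add: sums_iff)
qed

lemma tendsto_Abel_nonneg:
  fixes w :: "nat \<Rightarrow> real"
  assumes "w sums l" "\<And>N. w N \<ge> 0"
  shows "((\<lambda>r. \<Sum>N. w N * r ^ N) \<longlongrightarrow> l) (at_left 1)"
proof -
  have "((\<lambda>r. \<Sum>N. w N * r ^ N) \<longlongrightarrow> suminf (\<lambda>N. w N * 1 ^ N)) (at_left 1)"
  proof (rule conjunct2[OF conjunct2[OF tannerys_theorem[where M = w]]])
    show "((\<lambda>r. w N * r ^ N) \<longlongrightarrow> w N * 1 ^ N) (at_left 1)" for N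
      by (intro tendsto_intros)
    have "\<forall>\<^sub>F r in at_left (1::real). 0 < r \<and> r < 1"
      by (rule eventually_at_leftI[of 0]) auto
    then have "\<forall>\<^sub>F x in sequentially \<times>\<^sub>F at_left (1::real). 0 < snd x \<and> snd x < 1"
      by (rule eventually_compose_filterlim[OF _ filterlim_snd])
    then show "\<forall>\<^sub>F (N, r) in sequentially \<times>\<^sub>F at_left (1::real). norm (w N * r ^ N) \<le> w N"
      by eventually_elim (use assms(2) in \<open>auto simp: abs_mult power_abs intro!: mult_left_le power_le_one\<close>)
  qed (use assms in \<open>auto simp: sums_iff\<close>)
  then show ?thesis using assms by (simp add: sums_iff)
qed

text \<open>Indexing by the integers lets windows and shifts run below 0. Slow decrease survives the
  join at -1 as soon as a 0 is bounded below by the negative of the step constant.\<close>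

definition extend_zero :: "(nat \<Rightarrow> real) \<Rightarrow> int \<Rightarrow> real" where
  "extend_zero a j = (if j \<ge> 0 then a (nat j) else 0)"

lemma extend_zero_of_nat [simp]: "extend_zero a (int n) = a n"
  by (simp add: extend_zero_def)

lemma conv_int_sums:
  assumes "(\<lambda>k. extend_zero a (m + k) * p k) summable_on UNIV"
  shows "(\<lambda>N. a N * p (int N - m)) sums conv_int p (extend_zero a) m"
proof -
  let ?f = "\<lambda>j. extend_zero a j * p (j - m)"
  have "((\<lambda>k. extend_zero a (m + k) * p k) has_sum conv_int p (extend_zero a) m) UNIV"
    unfolding conv_int_def using assms by (rule has_sum_infsum)
  moreover have "bij_betw (\<lambda>k. m + k) UNIV UNIV"
    by (rule bij_betwI[where g = "\<lambda>j. j - m"]) auto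
  ultimately have "(?f has_sum conv_int p (extend_zero a) m) UNIV"
    using has_sum_reindex_bij_betw[of "\<lambda>k. m + k" UNIV UNIV ?f] by simp
  moreover have "(?f has_sum conv_int p (extend_zero a) m) UNIV \<longleftrightarrow>
      (?f has_sum conv_int p (extend_zero a) m) (range int)"
  proof (rule has_sum_cong_neutral)
    fix j assume "j \<in> UNIV - range int"
    then have "j < 0" by (metis DiffE nonneg_int_cases not_le rangeI)
    then show "?f j = 0" by (simp add: extend_zero_def)
  qed auto
  ultimately have "((?f \<circ> int) has_sum conv_int p (extend_zero a) m) UNIV"
    by (simp add: has_sum_reindex)
  then show ?thesis using has_sum_imp_sums by (force simp: o_def)
qed

lemma slow_decrease_telescope:
  fixes s :: "int \<Rightarrow> real" and b :: real
  assumes "\<And>j. k \<le> j \<Longrightarrow> s j - b \<le> s (j + 1)" "k \<le> i" "i \<le> j"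
  shows "s i - b * (j - i) \<le> s j"
  using \<open>i \<le> j\<close>
proof (induction j rule: int_ge_induct)
  case (step j)
  then show ?case using assms(1)[of j] assms(2) by (simp add: algebra_simps)
qed simp

context positive_kernel
begin

text \<open>Adding D (N + 1) makes the terms non-negative, so their Abel limit is a genuine sum; the
  added part converges by the first moment of p and is subtracted afterwards.\<close>

lemma one_sided_Abel_conv:
  fixes a :: "nat \<Rightarrow> real" and D :: real
  assumes lower: "\<And>N. - D * (N + 1) \<le> a N" and D: "D \<ge> 0"
    and summable: "\<And>r n. 0 < r \<Longrightarrow> r < 1 \<Longrightarrow> summable (\<lambda>N. a N * p (int N - n) * r ^ N)"
    and lim: "\<And>n. ((\<lambda>r. \<Sum>N. a N * p (int N - n) * r ^ N) \<longlongrightarrow> g n) (at_left 1)"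
    and M: "\<And>n. g n \<le> M"
  obtains A :: real where "\<And>j. \<bar>extend_zero a j\<bar> \<le> A * (1 + \<bar>real_of_int j\<bar>)" "conv_int p (extend_zero a) = g"
proof -
  define w where "w = (\<lambda>N. real N + 1)"
  have wbound: "\<bar>extend_zero w j\<bar> \<le> (1::real) * (1 + \<bar>real_of_int j\<bar>)" for j
    by (auto simp: extend_zero_def w_def)
  have wsums: "(\<lambda>N. w N * p (int N - n)) sums conv_int p (extend_zero w) n" for n
    by (intro conv_int_sums conv_summable[OF wbound])
  have wsummable: "summable (\<lambda>N. w N * p (int N - n) * r ^ N)" if "0 < r" "r < 1" for r n
  proof (rule summable_comparison_test'[OF sums_summable[OF wsums[of n]]])
    fix N show "norm (w N * p (int N - n) * r ^ N) \<le> w N * p (int N - n)"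
      using that nonneg[of "int N - n"] by (auto simp: w_def abs_mult power_abs intro!: mult_left_le power_le_one)
  qed
  have vsums: "(\<lambda>N. a N * p (int N - n) + D * (w N * p (int N - n))) sums (g n + D * conv_int p (extend_zero w) n)" for n
  proof (rule sums_of_tendsto_Abel_nonneg)
    show "0 \<le> a N * p (int N - n) + D * (w N * p (int N - n))" for N
    proof -
      have "0 \<le> (a N + D * w N) * p (int N - n)"
        using lower[of N] by (intro mult_nonneg_nonneg nonneg) (simp add: w_def algebra_simps)
      then show ?thesis by (simp add: algebra_simps)
    qed
    have eq: "(a N * p (int N - n) + D * (w N * p (int N - n))) * r ^ N
        = a N * p (int N - n) * r ^ N + D * (w N * p (int N - n) * r ^ N)" for N r
      by (simp add: algebra_simps)
    show "summable (\<lambda>N. (a N * p (int N - n) + D * (w N * p (int N - n))) * r ^ N)" if "0 < r" "r < 1" for r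
      unfolding eq by (intro summable_add summable_mult summable wsummable that)
    have "((\<lambda>r. (\<Sum>N. a N * p (int N - n) * r ^ N) + D * (\<Sum>N. w N * p (int N - n) * r ^ N))
        \<longlongrightarrow> g n + D * conv_int p (extend_zero w) n) (at_left 1)"
      by (intro tendsto_intros lim tendsto_Abel_nonneg wsums) (simp add: w_def nonneg)
    then show "((\<lambda>r. \<Sum>N. (a N * p (int N - n) + D * (w N * p (int N - n))) * r ^ N)
        \<longlongrightarrow> g n + D * conv_int p (extend_zero w) n) (at_left 1)"
    proof (rule Lim_transform_eventually)
      show "\<forall>\<^sub>F r in at_left 1. (\<Sum>N. a N * p (int N - n) * r ^ N) + D * (\<Sum>N. w N * p (int N - n) * r ^ N)
          = (\<Sum>N. (a N * p (int N - n) + D * (w N * p (int N - n))) * r ^ N)"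
        unfolding eq
        by (rule eventually_at_leftI[of 0])
           (auto simp: suminf_add[symmetric] suminf_mult summable_mult summable wsummable)
    qed
  qed
  have asums: "(\<lambda>N. a N * p (int N - n)) sums g n" for n
    using sums_diff[OF vsums[of n] sums_mult[OF wsums[of n], of D]] by simp
  define W where "W = (\<Sum>\<^sub>\<infinity>k. (1 + \<bar>real_of_int k\<bar>) * p k)"
  have W: "conv_int p (extend_zero w) n \<le> (1 + \<bar>real_of_int n\<bar>) * W" for n
  proof -
    have "conv_int p (extend_zero w) n \<le> (\<Sum>\<^sub>\<infinity>k. (1 + \<bar>real_of_int n\<bar>) * ((1 + \<bar>real_of_int k\<bar>) * p k))"
      unfolding conv_int_def
    proof (rule infsum_mono)
      fix k
      have "extend_zero w (n + k) \<le> 1 + \<bar>real_of_int (n + k)\<bar>" using wbound[of "n + k"] by simp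
      also have "\<dots> \<le> 1 + \<bar>real_of_int n\<bar> + \<bar>real_of_int k\<bar>" by simp
      also have "\<dots> \<le> (1 + \<bar>real_of_int n\<bar>) * (1 + \<bar>real_of_int k\<bar>)" by (simp add: algebra_simps)
      finally have "extend_zero w (n + k) * p k \<le> ((1 + \<bar>real_of_int n\<bar>) * (1 + \<bar>real_of_int k\<bar>)) * p k"
        by (rule mult_right_mono) (rule nonneg)
      then show "extend_zero w (n + k) * p k \<le> (1 + \<bar>real_of_int n\<bar>) * ((1 + \<bar>real_of_int k\<bar>) * p k)"
        by (simp add: mult.assoc)
    qed (intro conv_summable[OF wbound] summable_on_cmult_right moment)+
    also have "\<dots> = (1 + \<bar>real_of_int n\<bar>) * W"
      unfolding W_def by (intro infsum_cmult_right moment)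
    finally show ?thesis .
  qed
  \<comment> \<open>The quotient is the upper bound obtained from the term N = n, whose kernel value
    is p 0; the extra D makes A >= D, so that the lower bound is covered too.\<close>
  define A where "A = (\<bar>M\<bar> + D * W) / p 0 + D"
  have "W \<ge> 0" unfolding W_def using nonneg by (intro infsum_nonneg) auto
  then have "A \<ge> D" using D pos by (simp add: A_def)
  have upper: "a N \<le> A * (1 + N)" for N
  proof -
    let ?v = "\<lambda>k. a k * p (int k - int N) + D * (w k * p (int k - int N))"
    have "?v N \<le> g N + D * conv_int p (extend_zero w) N"
    proof -
      have "0 \<le> ?v k" for k
      proof -
        have "0 \<le> (a k + D * w k) * p (int k - int N)"
          using lower[of k] by (intro mult_nonneg_nonneg nonneg) (simp add: w_def algebra_simps)
        then show ?thesis by (simp add: algebra_simps)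
      qed
      then have "sum ?v {N} \<le> suminf ?v"
        by (intro sum_le_suminf sums_summable[OF vsums]) auto
      then show ?thesis using sums_unique[OF vsums[of "int N"]] by simp
    qed
    also have "\<dots> \<le> \<bar>M\<bar> * (1 + N) + D * ((1 + N) * W)"
    proof (rule add_mono)
      show "D * conv_int p (extend_zero w) (int N) \<le> D * ((1 + N) * W)"
        using W[of "int N"] D by (intro mult_left_mono) auto
      have "g N \<le> \<bar>M\<bar> * 1" using M[of "int N"] by simp
      also have "\<dots> \<le> \<bar>M\<bar> * (1 + N)" by (rule mult_left_mono) auto
      finally show "g N \<le> \<bar>M\<bar> * (1 + N)" .
    qed
    also have "\<dots> = (\<bar>M\<bar> + D * W) * (1 + N)" by (simp add: algebra_simps)
    finally have "a N * p 0 \<le> (\<bar>M\<bar> + D * W) * (1 + N)"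
      using D nonneg[of 0] by (simp add: w_def algebra_simps) (smt (verit) mult_nonneg_nonneg of_nat_0_le_iff)
    then have "a N \<le> (\<bar>M\<bar> + D * W) * (1 + N) / p 0" using pos by (simp add: field_simps)
    also have "\<dots> \<le> A * (1 + N)" using D pos by (simp add: A_def field_simps)
    finally show ?thesis .
  qed
  have "\<bar>a N\<bar> \<le> A * (1 + N)" for N
  proof -
    have "D * (1 + N) \<le> A * (1 + N)" using \<open>A \<ge> D\<close> by (intro mult_right_mono) auto
    then show ?thesis using upper[of N] lower[of N] by (simp add: abs_le_iff algebra_simps)
  qed
  then have growth: "\<bar>extend_zero a j\<bar> \<le> A * (1 + \<bar>real_of_int j\<bar>)" for j
    using \<open>A \<ge> D\<close> D by (auto simp: extend_zero_def)
       (metis abs_ge_zero of_nat_nat)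
  have "conv_int p (extend_zero a) n = g n" for n
    using sums_unique2[OF conv_int_sums[OF conv_summable[OF growth]] asums] .
  then show ?thesis using that[OF growth] by blast
qed

lemma Abel_conv_tauberian:
  fixes a :: "nat \<Rightarrow> real" and B :: real
  assumes a: "- B \<le> a 0" "\<And>N. a N - B \<le> a (Suc N)" and B: "B > 0"
    and summable: "\<And>r n. 0 < r \<Longrightarrow> r < 1 \<Longrightarrow> summable (\<lambda>N. a N * p (int N - n) * r ^ N)"
    and lim: "\<And>n. ((\<lambda>r. \<Sum>N. a N * p (int N - n) * r ^ N) \<longlongrightarrow> g n) (at_left 1)"
    and M: "\<And>n. \<bar>g n\<bar> \<le> M"
  shows "\<exists>R. \<forall>N. \<bar>a N\<bar> \<le> R"
    and "(\<And>\<epsilon>. (\<epsilon>::real) > 0 \<Longrightarrow> \<forall>\<^sub>F N in sequentially. a N - \<epsilon> \<le> a (Suc N)) \<Longrightarrow>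
      (g \<longlongrightarrow> 0) at_top \<Longrightarrow> a \<longlonglongrightarrow> 0"
proof -
  let ?s = "extend_zero a"
  have Suc: "nat (j + 1) = Suc (nat j)" if "j \<ge> 0" for j using that by simp
  \<comment> \<open>At j = -1 the step leads from the value 0 to a 0; this is where the bound on a 0
    enters.\<close>
  have step: "?s j - B \<le> ?s (j + 1)" for j
    using a B Suc by (cases "j = -1") (auto simp: extend_zero_def)
  have slow: "?s i - B * (j - i) \<le> ?s j" if "i \<le> j" for i j
    using slow_decrease_telescope[of i ?s B i j] step that by auto
  \<comment> \<open>Telescoping starts at -1, where the extension vanishes, which accounts for N + 1
    steps.\<close>
  have lower: "- B * (N + 1) \<le> a N" for N
    using slow[of "-1" "int N"] by (simp add: extend_zero_def[of a "-1"] algebra_simps)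
  obtain A where A: "\<And>j. \<bar>?s j\<bar> \<le> A * (1 + \<bar>real_of_int j\<bar>)" "conv_int p ?s = g"
  proof (rule one_sided_Abel_conv[OF lower _ summable lim])
    show "g n \<le> M" for n using M[of n] by simp
  qed (use B in auto)
  obtain R where R: "\<And>j. \<bar>?s j\<bar> \<le> R"
    using slowly_decreasing_conv_bounded[OF A(1) slow B] M A(2) by metis
  then show "\<exists>R. \<forall>N. \<bar>a N\<bar> \<le> R" by (metis extend_zero_of_nat)
  show "a \<longlonglongrightarrow> 0" if ev: "\<And>\<epsilon>. (\<epsilon>::real) > 0 \<Longrightarrow> \<forall>\<^sub>F N in sequentially. a N - \<epsilon> \<le> a (Suc N)"
    and "(g \<longlongrightarrow> 0) at_top"
  proof -
    have "(?s \<longlongrightarrow> 0) at_top"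
    proof (rule slowly_decreasing_conv_tendsto_0[OF R])
      fix \<epsilon> :: real assume "\<epsilon> > 0"
      then obtain N where N: "\<And>n. n \<ge> N \<Longrightarrow> a n - \<epsilon> \<le> a (Suc n)"
        using ev by (auto simp: eventually_sequentially)
      have "?s j - \<epsilon> \<le> ?s (j + 1)" if "int N \<le> j" for j
        using N[of "nat j"] that Suc[of j] by (auto simp: extend_zero_def)
      then show "\<exists>N. \<forall>i j. N \<le> i \<longrightarrow> i \<le> j \<longrightarrow> ?s i - \<epsilon> * (j - i) \<le> ?s j"
        using slow_decrease_telescope[of "int N" ?s \<epsilon>] by blast
    qed (use A(2) that in simp)
    from filterlim_compose[OF this filterlim_int_sequentially] show ?thesis by simp
  qed
qed

end

section \<open>Boundary behaviour\<close>

lemma powser_abs_summable: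
  fixes f :: "nat \<Rightarrow> complex"
  assumes "\<And>z. norm z < 1 \<Longrightarrow> summable (\<lambda>n. f n * z ^ n)" "norm z < 1"
  shows "summable (\<lambda>n. norm (f n * z ^ n))"
proof (rule powser_insidea)
  have "norm (complex_of_real ((1 + norm z) / 2)) = (1 + norm z) / 2"
    unfolding norm_of_real by (simp add: add_nonneg_nonneg)
  then show "summable (\<lambda>n. f n * complex_of_real ((1 + norm z) / 2) ^ n)"
    and "norm z < norm (complex_of_real ((1 + norm z) / 2))"
    using assms by auto
qed

lemma partial_sums_generating_function:
  fixes f :: "nat \<Rightarrow> complex"
  assumes F: "\<And>z. norm z < 1 \<Longrightarrow> (\<lambda>n. f n * z ^ n) sums F z" and z: "norm z < 1"
  shows "(\<lambda>N. ((\<Sum>n\<le>N. f n) - F1) * z ^ N) sums ((F z - F1) / (1 - z))"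
    and "summable (\<lambda>N. norm (((\<Sum>n\<le>N. f n) - F1) * z ^ N))"
proof -
  have *: "(\<lambda>N. ((\<Sum>n\<le>N. f n) - F1) * z ^ N) sums ((F z - F1) / (1 - z))" if z: "norm z < 1" for z
  proof -
    have "(\<lambda>k. \<Sum>i\<le>k. (f i * z ^ i) * z ^ (k - i)) sums ((\<Sum>k. f k * z ^ k) * (\<Sum>k. z ^ k))"
    proof (rule Cauchy_product_sums)
      show "summable (\<lambda>k. norm (f k * z ^ k))"
        by (rule powser_abs_summable) (use F z sums_summable in blast)+
      show "summable (\<lambda>k. norm (z ^ k))"
        using z by (simp add: norm_power)
    qed
    moreover have "(\<Sum>i\<le>k. (f i * z ^ i) * z ^ (k - i)) = (\<Sum>n\<le>k. f n) * z ^ k" for k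
      unfolding sum_distrib_right by (rule sum.cong) (auto simp flip: power_add)
    moreover have "(\<Sum>k. f k * z ^ k) = F z" using F[OF z] by (simp add: sums_iff)
    moreover have "(\<Sum>k. z ^ k) = 1 / (1 - z)" using z by (rule suminf_geometric)
    ultimately have "(\<lambda>N. (\<Sum>n\<le>N. f n) * z ^ N) sums (F z * (1 / (1 - z)))" by simp
    moreover have "(\<lambda>N. F1 * z ^ N) sums (F1 * (1 / (1 - z)))"
      using z by (intro sums_mult geometric_sums)
    ultimately have "(\<lambda>N. (\<Sum>n\<le>N. f n) * z ^ N - F1 * z ^ N) sums (F z * (1 / (1 - z)) - F1 * (1 / (1 - z)))"
      by (rule sums_diff)
    then show ?thesis by (simp add: algebra_simps diff_divide_distrib)
  qed
  show "(\<lambda>N. ((\<Sum>n\<le>N. f n) - F1) * z ^ N) sums ((F z - F1) / (1 - z))" by (rule *[OF z])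
  show "summable (\<lambda>N. norm (((\<Sum>n\<le>N. f n) - F1) * z ^ N))"
    by (rule powser_abs_summable[OF sums_summable[OF *] z])
qed

text \<open>Modulation does not enlarge the support, so one neighbourhood and one symbol G will
  serve for all frequencies.\<close>

lemma test_fun_modulated:
  assumes "smooth_fun \<phi>" "\<And>x. \<bar>x\<bar> > \<delta> \<Longrightarrow> \<phi> x = 0" "cball 0 \<delta> \<subseteq> V"
  shows "test_fun V (\<lambda>x. exp (c * complex_of_real x) * \<phi> x)"
proof -
  have "{x. exp (c * complex_of_real x) * \<phi> x \<noteq> 0} \<subseteq> cball 0 \<delta>"
    using assms(2) by (force simp: dist_real_def)
  then have sub: "closure {x. exp (c * complex_of_real x) * \<phi> x \<noteq> 0} \<subseteq> cball 0 \<delta>"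
    by (intro closure_minimal) auto
  then have "compact (closure {x. exp (c * complex_of_real x) * \<phi> x \<noteq> 0})"
    using compact_Int_closed[of "cball 0 \<delta>" "closure {x. exp (c * complex_of_real x) * \<phi> x \<noteq> 0}"]
    by (simp add: Int_absorb1)
  then show ?thesis
    unfolding test_fun_def using sub assms by (auto intro!: smooth_fun_mult smooth_fun_exp_linear)
qed

lemma test_fun_mono: "test_fun V \<phi> \<Longrightarrow> V \<subseteq> U \<Longrightarrow> test_fun U \<phi>"
  unfolding test_fun_def by auto

lemma fourier_modulated:
  "fourier (\<lambda>x. exp (- \<i> * of_real a * complex_of_real x) * \<phi> x) t = fourier \<phi> (t + a)"
proof -
  have "- \<i> * complex_of_real (t * x) + - \<i> * of_real a * complex_of_real x = - \<i> * complex_of_real ((t + a) * x)" for x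
    by (simp add: algebra_simps)
  then show ?thesis
    unfolding fourier_def by (simp only: mult.assoc[symmetric] exp_add[symmetric])
qed

text \<open>On a circle of fixed radius r absolute summability permits termwise integration, and
  integrating \<open>cis \<theta> ^ N\<close> against the test function gives its transform at
  -N.\<close>

lemma integral_powser_circle:
  fixes u :: "nat \<Rightarrow> complex"
  assumes \<phi>: "integrable lborel \<phi>" and r: "0 \<le> r"
    and u: "summable (\<lambda>N. norm (u N * of_real r ^ N))"
    and H: "\<And>\<theta>. (\<lambda>N. u N * (of_real r * cis \<theta>) ^ N) sums H \<theta>"
  shows "(\<lambda>N. u N * of_real r ^ N * fourier \<phi> (- real N)) sums (LINT \<theta>|lborel. H \<theta> * \<phi> \<theta>)"
proof -
  let ?f = "\<lambda>N \<theta>. u N * of_real r ^ N * (exp (- \<i> * complex_of_real (- real N * \<theta>)) * \<phi> \<theta>)"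
  have exp_cis: "exp (- \<i> * complex_of_real (- real N * \<theta>)) = cis \<theta> ^ N" for N \<theta>
    by (simp add: cis_conv_exp mult_ac flip: exp_of_nat_mult)
  have nf: "norm (?f N \<theta>) = norm (u N * of_real r ^ N) * norm (\<phi> \<theta>)" for N \<theta>
    unfolding exp_cis by (simp add: norm_mult norm_power)
  have int: "integrable lborel (?f N)" for N
  proof (rule Bochner_Integration.integrable_mult_right)
    have [measurable]: "\<phi> \<in> borel_measurable lborel" using \<phi> by simp
    show "integrable lborel (\<lambda>\<theta>. exp (- \<i> * complex_of_real (- real N * \<theta>)) * \<phi> \<theta>)"
    proof (rule Bochner_Integration.integrable_bound[OF \<phi>])
      show "AE \<theta> in lborel. norm (exp (- \<i> * complex_of_real (- real N * \<theta>)) * \<phi> \<theta>) \<le> norm (\<phi> \<theta>)"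
        unfolding exp_cis by (simp add: norm_mult norm_power)
    qed measurable
  qed
  have "(\<lambda>N. LINT \<theta>|lborel. ?f N \<theta>) sums (LINT \<theta>|lborel. (\<Sum>N. ?f N \<theta>))"
  proof (rule sums_integral[OF int])
    show "AE \<theta> in lborel. summable (\<lambda>N. norm (?f N \<theta>))"
      unfolding nf by (intro AE_I2 summable_mult2 u)
    show "summable (\<lambda>N. LINT \<theta>|lborel. norm (?f N \<theta>))"
      unfolding nf by (simp add: summable_mult2 u)
  qed
  moreover have "(LINT \<theta>|lborel. ?f N \<theta>) = u N * of_real r ^ N * fourier \<phi> (- real N)" for N
    by (simp only: fourier_def integral_mult_right_zero)
  moreover have "(\<Sum>N. ?f N \<theta>) = H \<theta> * \<phi> \<theta>" for \<theta>
  proof -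
    have "?f N \<theta> = u N * (of_real r * cis \<theta>) ^ N * \<phi> \<theta>" for N
      unfolding exp_cis by (simp add: power_mult_distrib)
    then show ?thesis using sums_unique[OF sums_mult2[OF H], symmetric] by (simp only:)
  qed
  ultimately show ?thesis by (simp only:)
qed

section \<open>Decay of the kernel and pairings with bounded symbols\<close>

lemma integrable_decay:
  fixes \<psi> :: "real \<Rightarrow> real"
  assumes "\<psi> \<in> borel_measurable borel" "\<And>t. \<psi> t \<ge> 0" "\<And>t. \<psi> t \<le> C / (1 + t\<^sup>2)\<^sup>2"
  shows "integrable lborel \<psi>"
proof (rule Bochner_Integration.integrable_bound)
  have "integrable lborel (\<lambda>x::real. inverse (1 + x\<^sup>2))"
    using integrable_inverse_1_plus_square by (simp add: set_integrable_def)
  then show "integrable lborel (\<lambda>x::real. \<bar>C\<bar> * inverse (1 + x\<^sup>2))"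
    by (rule Bochner_Integration.integrable_mult_right)
  show "AE t in lborel. norm (\<psi> t) \<le> norm (\<bar>C\<bar> * inverse (1 + t\<^sup>2))"
  proof (rule AE_I2)
    fix t :: real
    have "1 + t\<^sup>2 \<le> (1 + t\<^sup>2)\<^sup>2"
      by (rule self_le_power) auto
    moreover have "0 < 1 + t\<^sup>2" by (simp add: add_pos_nonneg)
    ultimately have "C / (1 + t\<^sup>2)\<^sup>2 \<le> \<bar>C\<bar> / (1 + t\<^sup>2)"
      by (intro frac_le) auto
    then show "norm (\<psi> t) \<le> norm (\<bar>C\<bar> * inverse (1 + t\<^sup>2))"
      using assms(2,3)[of t] by (simp add: abs_mult divide_inverse)
  qed
qed (use assms in simp)

text \<open>Decay of order four absorbs the weight 1 + |k| and still leaves a comparison with the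
  sum of 1/n^2, made separately on k >= 0 and k <= -1.\<close>

lemma positive_kernel_decay:
  fixes \<psi> :: "real \<Rightarrow> real"
  assumes nn: "\<And>t. \<psi> t \<ge> 0" and pos: "\<psi> 0 > 0" and C: "\<And>t. \<psi> t \<le> C / (1 + t\<^sup>2)\<^sup>2"
  shows "positive_kernel (\<lambda>k. \<psi> (real_of_int k))"
proof
  let ?w = "\<lambda>k. (1 + \<bar>real_of_int k\<bar>) * \<psi> (real_of_int k)"
  have bound: "?w k \<le> 2 * C * inverse (1 + (real_of_int k)\<^sup>2)" for k
  proof -
    define x where "x = \<bar>real_of_int k\<bar>"
    have "0 < (1::real) + x\<^sup>2" by (simp add: add_pos_nonneg)
    have "x \<le> 1 + x\<^sup>2" using sum_squares_bound[of x 1] by (simp add: power2_eq_square x_def)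
    then have "1 + x \<le> 2 * (1 + x\<^sup>2)" using zero_le_power2[of x] unfolding distrib_left by linarith
    have "C \<ge> 0" using C[of 0] nn[of 0] by simp
    have "?w k \<le> (2 * (1 + x\<^sup>2)) * (C / (1 + x\<^sup>2)\<^sup>2)"
      using \<open>1 + x \<le> 2 * (1 + x\<^sup>2)\<close> nn[of k] C[of k] \<open>C \<ge> 0\<close> by (intro mult_mono) (auto simp: x_def)
    also have "\<dots> = 2 * C * inverse (1 + x\<^sup>2)"
    proof -
      have "(2 * y) * (C / y\<^sup>2) = 2 * C * inverse y" if "y > 0" for y
        using that by (simp add: power2_eq_square field_simps)
      from this[OF \<open>0 < 1 + x\<^sup>2\<close>] show ?thesis .
    qed
    finally show ?thesis by (simp add: x_def)
  qed
  have w0: "?w k \<ge> 0" for k using nn by simp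
  have "summable (\<lambda>n. inverse (real n ^ 2))" by (rule inverse_power_summable) simp
  then have s2: "summable (\<lambda>n. inverse (real (Suc n) ^ 2))" by (subst summable_Suc_iff)
  have "summable (\<lambda>n. ?w (int n))"
  \<comment> \<open>The comparison is with 1/(n + 1)^2 to avoid n = 0; the extra factor 2 comes from
    (n + 1)^2 <= 2 (1 + n^2).\<close>
  proof (rule summable_comparison_test'[OF summable_mult[OF s2], of 0 _ "2 * C * 2"])
    fix n :: nat
    have "C \<ge> 0" using C[of 0] nn[of 0] by simp
    have "(real (Suc n))\<^sup>2 \<le> 2 * (1 + (real n)\<^sup>2)" using sum_squares_bound[of "real n" 1] by (simp add: power2_eq_square algebra_simps)
    then have "inverse (2 * (1 + (real n)\<^sup>2)) \<le> inverse ((real (Suc n))\<^sup>2)"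
      by (intro le_imp_inverse_le) auto
    then have "inverse (1 + (real n)\<^sup>2) \<le> 2 * inverse ((real (Suc n))\<^sup>2)"
      unfolding inverse_mult_distrib by simp
    then have "2 * C * inverse (1 + (real n)\<^sup>2) \<le> 2 * C * (2 * inverse ((real (Suc n))\<^sup>2))"
      using \<open>C \<ge> 0\<close> by (intro mult_left_mono) auto
    then show "norm (?w (int n)) \<le> 2 * C * 2 * inverse (real (Suc n) ^ 2)"
      using bound[of "int n"] w0[of "int n"] by simp
  qed
  then have "(\<lambda>n. ?w (int n)) summable_on UNIV"
    by (rule summable_nonneg_imp_summable_on) (rule w0)
  then have pos: "?w summable_on range int"
    by (subst summable_on_reindex) (auto simp: o_def)
  have "summable (\<lambda>n. ?w (- int (Suc n)))"
  proof (rule summable_comparison_test'[OF summable_mult[OF s2], of 0 _ "2 * C"])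
    fix n :: nat
    have "C \<ge> 0" using C[of 0] nn[of 0] by simp
    have "inverse (1 + (real (Suc n))\<^sup>2) \<le> inverse ((real (Suc n))\<^sup>2)"
      by (intro le_imp_inverse_le) auto
    then have "2 * C * inverse (1 + (real (Suc n))\<^sup>2) \<le> 2 * C * inverse ((real (Suc n))\<^sup>2)"
      using \<open>C \<ge> 0\<close> by (intro mult_left_mono) auto
    moreover have "(real_of_int (- int (Suc n)))\<^sup>2 = (real (Suc n))\<^sup>2"
      by (simp only: of_int_minus of_int_of_nat_eq power2_minus)
    then have "?w (- int (Suc n)) \<le> 2 * C * inverse (1 + (real (Suc n))\<^sup>2)"
      using bound[of "- int (Suc n)"] by (simp only:)
    moreover have "norm (?w (- int (Suc n))) = ?w (- int (Suc n))"
      by (simp only: real_norm_def abs_of_nonneg[OF w0])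
    ultimately show "norm (?w (- int (Suc n))) \<le> 2 * C * inverse (real (Suc n) ^ 2)"
      by linarith
  qed
  then have "(\<lambda>n. ?w (- int (Suc n))) summable_on UNIV"
    by (rule summable_nonneg_imp_summable_on) (rule w0)
  then have neg: "?w summable_on range (\<lambda>n. - int (Suc n))"
    by (subst summable_on_reindex) (auto simp: o_def inj_def)
  have "?w summable_on (range int \<union> range (\<lambda>n. - int (Suc n)))"
    by (rule summable_on_Un_disjoint[OF pos neg]) auto
  also have "range int \<union> range (\<lambda>n. - int (Suc n)) = UNIV"
  proof (rule UNIV_eq_I[symmetric])
    fix k :: int show "k \<in> range int \<union> range (\<lambda>n. - int (Suc n))"
      by (cases k) auto
  qed
  finally show "?w summable_on UNIV" .
qed (use nn pos in auto)

text \<open>The bound sup |G| times the integral of psi is uniform in x by translation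
  invariance.\<close>

lemma bounded_pairing:
  assumes G: "pm_symbol G" and \<psi>: "integrable lborel \<psi>" "\<And>t. \<psi> t \<ge> 0"
  shows "\<exists>M. \<forall>x. norm (LINT t|lborel. G t * complex_of_real (\<psi> (t - x))) \<le> M"
proof -
  obtain K where K: "\<And>t. norm (G t) \<le> K"
    using G unfolding pm_symbol_def bounded_iff by auto
  have [measurable]: "G \<in> borel_measurable borel" "\<psi> \<in> borel_measurable borel"
    using G \<psi> by (auto simp: pm_symbol_def)
  have shift: "integrable lborel (\<lambda>t. \<psi> (t - x))" "(LINT t|lborel. \<psi> (t - x)) = (LINT t|lborel. \<psi> t)" for x
    using lborel_integrable_real_affine[OF \<psi>(1), of 1 "- x"] lborel_integral_real_affine[of 1 \<psi> "- x"] by auto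
  have "norm (LINT t|lborel. G t * complex_of_real (\<psi> (t - x))) \<le> (LINT t|lborel. K * \<psi> (t - x))" for x
  proof (rule Bochner_Integration.integral_norm_bound_integral)
    show 1: "integrable lborel (\<lambda>t. K * \<psi> (t - x))" using shift by simp
    show 2: "norm (G t * complex_of_real (\<psi> (t - x))) \<le> K * \<psi> (t - x)" for t
      using K \<psi>(2) by (simp add: norm_mult mult_right_mono)
    have "K * \<psi> (t - x) \<le> norm (K * \<psi> (t - x))" for t by simp
    then show "integrable lborel (\<lambda>t. G t * complex_of_real (\<psi> (t - x)))"
      by (intro Bochner_Integration.integrable_bound[OF 1] AE_I2 order_trans[OF 2]) measurable
  qed
  then show ?thesis using shift by auto
qed

text \<open>Moving the translation onto G gives the integrand G(x + t) psi(t), which tends to 0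
  pointwise and is dominated by a multiple of psi.\<close>

lemma pairing_tendsto_0:
  assumes G: "pf_symbol G" and \<psi>: "integrable lborel \<psi>" "\<And>t. \<psi> t \<ge> 0"
  shows "((\<lambda>x. LINT t|lborel. G t * complex_of_real (\<psi> (t - x))) \<longlongrightarrow> 0) at_top"
proof -
  obtain K where K: "\<And>t. norm (G t) \<le> K"
    using G unfolding pf_symbol_def pm_symbol_def bounded_iff by auto
  have [measurable]: "G \<in> borel_measurable borel" "\<psi> \<in> borel_measurable borel"
    using G \<psi> by (auto simp: pf_symbol_def pm_symbol_def)
  have "(LINT t|lborel. G t * complex_of_real (\<psi> (t - x))) = (LINT t|lborel. G (x + t) * complex_of_real (\<psi> t))" for x
    using lborel_integral_real_affine[of 1 "\<lambda>t. G t * complex_of_real (\<psi> (t - x))" x] by simp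
  moreover have "((\<lambda>x. LINT t|lborel. G (x + t) * complex_of_real (\<psi> t)) \<longlongrightarrow> integral\<^sup>L lborel (\<lambda>_::real. 0)) at_top"
  proof (rule integral_dominated_convergence_at_top)
    show "integrable lborel (\<lambda>t. K * \<psi> t)" using \<psi> by simp
    show "\<forall>\<^sub>F x in at_top. AE t in lborel. norm (G (x + t) * complex_of_real (\<psi> t)) \<le> K * \<psi> t"
      using K \<psi>(2) by (intro always_eventually allI AE_I2) (simp add: norm_mult mult_right_mono)
    show "AE t in lborel. ((\<lambda>x. G (x + t) * complex_of_real (\<psi> t)) \<longlongrightarrow> 0) at_top"
    proof (rule AE_I2)
      fix t
      have "(G \<longlongrightarrow> 0) at_top"
        using G at_top_le_at_infinity unfolding pf_symbol_def by (blast intro: tendsto_mono)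
      then have "((\<lambda>x. G (x + t)) \<longlongrightarrow> 0) at_top"
        by (rule filterlim_compose) (subst add.commute, rule filterlim_tendsto_add_at_top[OF tendsto_const filterlim_ident])
      then show "((\<lambda>x. G (x + t) * complex_of_real (\<psi> t)) \<longlongrightarrow> 0) at_top"
        by (rule tendsto_mult_left_zero)
    qed
  qed measurable
  ultimately show ?thesis by simp
qed

text \<open>Testing the boundary distribution against the modulations of a single test function with
  non-negative Fourier transform turns the Abel means into convolutions with that transform.\<close>
lemma boundary_behavior_conv:
  fixes f :: "nat \<Rightarrow> complex"
  assumes F: "\<And>z. norm z < 1 \<Longrightarrow> (\<lambda>n. f n * z ^ n) sums F z"
    and bb: "boundary_behavior P (\<lambda>z. (F z - F1) / (z - 1)) 0"
  obtains \<psi> G where "P G" "positive_kernel (\<lambda>k. \<psi> (real_of_int k))" "integrable lborel \<psi>" "\<And>t. \<psi> t \<ge> 0"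
    "\<And>n::int. ((\<lambda>r. \<Sum>N. ((\<Sum>n\<le>N. f n) - F1) * of_real r ^ N * complex_of_real (\<psi> (real N - n)))
       \<longlongrightarrow> - ((LINT t|lborel. G t * complex_of_real (\<psi> (t - n))) / complex_of_real (2 * pi))) (at_left 1)"
    "\<And>n::int. \<And>r. 0 < r \<Longrightarrow> r < 1 \<Longrightarrow>
      summable (\<lambda>N. ((\<Sum>n\<le>N. f n) - F1) * of_real r ^ N * complex_of_real (\<psi> (real N - n)))"
proof -
  define S where "S N = (\<Sum>n\<le>N. f n) - F1" for N
  obtain a b T where ab: "a < 0" "0 < b"
    and T: "\<And>\<phi>. test_fun {a<..<b} \<phi> \<Longrightarrow>
       ((\<lambda>r. LINT \<theta>|lborel. (F (of_real r * cis \<theta>) - F1) / (of_real r * cis \<theta> - 1) * \<phi> \<theta>) \<longlongrightarrow> T \<phi>) (at_left 1)"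
    and loc: "\<And>x. x \<in> {a<..<b} \<Longrightarrow> \<exists>V G. open V \<and> x \<in> V \<and> V \<subseteq> {a<..<b} \<and> P G \<and>
       (\<forall>\<phi>. test_fun V \<phi> \<longrightarrow> T \<phi> = ft_inv_pair G \<phi>)"
    using bb unfolding boundary_behavior_def by blast
  obtain V G where V: "open V" "0 \<in> V" "V \<subseteq> {a<..<b}" and G: "P G"
    and TG: "\<And>\<phi>. test_fun V \<phi> \<Longrightarrow> T \<phi> = ft_inv_pair G \<phi>"
    using loc[of 0] ab by auto
  \<comment> \<open>The support radius is dictated by V, the neighbourhood of 0 on which the limit
    is given by the single symbol G.\<close>
  obtain \<delta> where \<delta>: "\<delta> > 0" "cball 0 \<delta> \<subseteq> V"
    using V(1,2) open_contains_cball by blast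
  obtain \<phi> \<psi> C where \<phi>: "smooth_fun \<phi>" "\<And>x. \<bar>x\<bar> > \<delta> \<Longrightarrow> \<phi> x = 0"
    and \<psi>: "\<And>t. fourier \<phi> (- t) = complex_of_real (\<psi> t)" "\<And>t. \<psi> t \<ge> 0" "\<psi> 0 > 0"
    "\<And>t. \<psi> t \<le> C / (1 + t\<^sup>2)\<^sup>2" "\<psi> \<in> borel_measurable borel"
    using positive_kernel_exists[OF \<delta>(1)] by metis
  define \<phi>n where "\<phi>n n x = exp (- \<i> * of_real n * complex_of_real x) * \<phi> x" for n x
  have test: "test_fun V (\<phi>n n)" for n
    unfolding \<phi>n_def[abs_def] by (rule test_fun_modulated[OF \<phi> \<delta>(2)])
  have fn: "fourier (\<phi>n n) (- t) = complex_of_real (\<psi> (t - n))" for n t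
    using \<psi>(1)[of "t - n"] unfolding \<phi>n_def[abs_def] fourier_modulated by simp
  have intn: "integrable lborel (\<phi>n n)" for n
  proof (rule integrable_continuous_vanishing)
    show "continuous_on UNIV (\<phi>n n)" using test[of n] unfolding test_fun_def by (blast intro: smooth_fun_continuous_on)
    show "\<phi>n n x = 0" if "x \<notin> cball 0 \<delta>" for x using that \<phi>(2)[of x] by (simp add: \<phi>n_def)
  qed simp
  have sums: "(\<lambda>N. S N * of_real r ^ N * complex_of_real (\<psi> (real N - n))) sums
      (- (LINT \<theta>|lborel. (F (of_real r * cis \<theta>) - F1) / (of_real r * cis \<theta> - 1) * \<phi>n n \<theta>))"
    if r: "0 < r" "r < 1" for r n
  proof -
    have "(\<lambda>N. S N * of_real r ^ N * fourier (\<phi>n n) (- real N)) sums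
        (LINT \<theta>|lborel. (F (of_real r * cis \<theta>) - F1) / (1 - of_real r * cis \<theta>) * \<phi>n n \<theta>)"
    proof (rule integral_powser_circle[OF intn])
      show "summable (\<lambda>N. norm (S N * of_real r ^ N))"
        unfolding S_def by (rule partial_sums_generating_function(2)[OF F]) (use r in auto)
      show "(\<lambda>N. S N * (of_real r * cis \<theta>) ^ N) sums ((F (of_real r * cis \<theta>) - F1) / (1 - of_real r * cis \<theta>))" for \<theta>
        unfolding S_def by (rule partial_sums_generating_function(1)[OF F]) (use r in \<open>auto simp: norm_mult\<close>)
    qed (use r in auto)
    \<comment> \<open>The generating function has denominator 1 - z, the hypothesis z - 1; this is
      the origin of the minus sign in the limit.\<close>
    also have "(\<lambda>\<theta>. (F (of_real r * cis \<theta>) - F1) / (1 - of_real r * cis \<theta>) * \<phi>n n \<theta>)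
      = (\<lambda>\<theta>. - ((F (of_real r * cis \<theta>) - F1) / (of_real r * cis \<theta> - 1) * \<phi>n n \<theta>))"
      by (rule ext) (metis minus_diff_eq minus_divide_right mult_minus_left)
    finally show ?thesis by (simp add: fn)
  qed
  show ?thesis
  proof (rule that[OF G _ _ \<psi>(2)])
    show "positive_kernel (\<lambda>k. \<psi> (real_of_int k))" by (rule positive_kernel_decay[OF \<psi>(2,3,4)])
    show "integrable lborel \<psi>" by (rule integrable_decay[OF \<psi>(5,2,4)])
    show "summable (\<lambda>N. ((\<Sum>n\<le>N. f n) - F1) * of_real r ^ N * complex_of_real (\<psi> (real N - n)))"
      if "0 < r" "r < 1" for r and n :: int
      using sums_summable[OF sums[OF that]] by (simp only: S_def)
    show "((\<lambda>r. \<Sum>N. ((\<Sum>n\<le>N. f n) - F1) * of_real r ^ N * complex_of_real (\<psi> (real N - n)))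
       \<longlongrightarrow> - ((LINT t|lborel. G t * complex_of_real (\<psi> (t - n))) / complex_of_real (2 * pi))) (at_left 1)" for n :: int
    proof (rule Lim_transform_eventually)
      have "T (\<phi>n n) = (LINT t|lborel. G t * complex_of_real (\<psi> (t - n))) / complex_of_real (2 * pi)"
        using TG[OF test[of n]] by (simp add: ft_inv_pair_def fn)
      then show "((\<lambda>r. - (LINT \<theta>|lborel. (F (of_real r * cis \<theta>) - F1) / (of_real r * cis \<theta> - 1) * \<phi>n n \<theta>))
          \<longlongrightarrow> - ((LINT t|lborel. G t * complex_of_real (\<psi> (t - n))) / complex_of_real (2 * pi))) (at_left 1)"
        using tendsto_minus[OF T[OF test_fun_mono[OF test[of n] V(3)]]] by simp
      show "\<forall>\<^sub>F r in at_left 1. - (LINT \<theta>|lborel. (F (of_real r * cis \<theta>) - F1) / (of_real r * cis \<theta> - 1) * \<phi>n n \<theta>)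
          = (\<Sum>N. ((\<Sum>n\<le>N. f n) - F1) * of_real r ^ N * complex_of_real (\<psi> (real N - n)))"
        by (rule eventually_at_leftI[of 0]) (use sums_unique[OF sums] in \<open>auto simp: S_def\<close>)
    qed
  qed
qed

section \<open>Passage to partial sums through real-linear functionals\<close>

text \<open>Kernel values and powers of r are real, so a real-linear L passes through them and
  reduces complex Abel means to real ones.\<close>

lemma bounded_linear_Abel_conv:
  fixes u :: "nat \<Rightarrow> complex" and L :: "complex \<Rightarrow> real"
  assumes L: "bounded_linear L"
    and lim: "((\<lambda>r. \<Sum>N. u N * of_real r ^ N * complex_of_real (q N)) \<longlongrightarrow> l) (at_left 1)"
    and sum: "\<And>r. 0 < r \<Longrightarrow> r < 1 \<Longrightarrow> summable (\<lambda>N. u N * of_real r ^ N * complex_of_real (q N))"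
  shows "((\<lambda>r. \<Sum>N. L (u N) * q N * r ^ N) \<longlongrightarrow> L l) (at_left 1)"
    and "0 < r \<Longrightarrow> r < 1 \<Longrightarrow> summable (\<lambda>N. L (u N) * q N * r ^ N)"
proof -
  have eq: "L (u N * of_real r ^ N * complex_of_real (q N)) = L (u N) * q N * r ^ N" for r N
  proof -
    have "u N * of_real r ^ N * complex_of_real (q N) = (q N * r ^ N) *\<^sub>R u N"
      by (simp add: scaleR_conv_of_real mult_ac)
    then show ?thesis by (simp add: linear_simps(5)[OF L])
  qed
  show "0 < r \<Longrightarrow> r < 1 \<Longrightarrow> summable (\<lambda>N. L (u N) * q N * r ^ N)"
    using bounded_linear.summable[OF L sum] by (simp add: eq)
  have "((\<lambda>r. L (\<Sum>N. u N * of_real r ^ N * complex_of_real (q N))) \<longlongrightarrow> L l) (at_left 1)"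
    by (rule bounded_linear.tendsto[OF L lim])
  then show "((\<lambda>r. \<Sum>N. L (u N) * q N * r ^ N) \<longlongrightarrow> L l) (at_left 1)"
  proof (rule Lim_transform_eventually)
    show "\<forall>\<^sub>F r in at_left 1. L (\<Sum>N. u N * of_real r ^ N * complex_of_real (q N)) = (\<Sum>N. L (u N) * q N * r ^ N)"
      by (rule eventually_at_leftI[of 0]) (use bounded_linear.suminf[OF L sum] in \<open>auto simp: eq\<close>)
  qed
qed

text \<open>\<open>P\<close> stands for either symbol class and \<open>L\<close> for
  \<open>Re\<close> or \<open>Im\<close>, so both claims of the theorem and the reality of F1 become
  instances.\<close>

lemma bounded_linear_boundary_tauberian:
  fixes f :: "nat \<Rightarrow> complex" and L :: "complex \<Rightarrow> real"
  assumes F: "\<And>z. norm z < 1 \<Longrightarrow> (\<lambda>n. f n * z ^ n) sums F z"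
    and bb: "boundary_behavior P (\<lambda>z. (F z - F1) / (z - 1)) 0"
    and P: "\<And>G. P G \<Longrightarrow> pm_symbol G" and L: "bounded_linear L"
    and lower: "\<And>n. - B \<le> L (f n)"
  shows "\<exists>R. \<forall>N. \<bar>L ((\<Sum>n\<le>N. f n) - F1)\<bar> \<le> R"
    and "(\<And>G. P G \<Longrightarrow> pf_symbol G) \<Longrightarrow>
      (\<And>\<epsilon>. (\<epsilon>::real) > 0 \<Longrightarrow> \<forall>\<^sub>F n in sequentially. - \<epsilon> \<le> L (f n)) \<Longrightarrow>
      (\<lambda>N. L ((\<Sum>n\<le>N. f n) - F1)) \<longlonglongrightarrow> 0"
proof -
  obtain \<psi> G where PG: "P G" and ker: "positive_kernel (\<lambda>k. \<psi> (real_of_int k))"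
    and \<psi>: "integrable lborel \<psi>" "\<And>t. \<psi> t \<ge> 0"
    and lim0: "\<And>n::int. ((\<lambda>r. \<Sum>N. ((\<Sum>n\<le>N. f n) - F1) * of_real r ^ N * complex_of_real (\<psi> (real N - n)))
       \<longlongrightarrow> - ((LINT t|lborel. G t * complex_of_real (\<psi> (t - n))) / complex_of_real (2 * pi))) (at_left 1)"
    and sum0: "\<And>n::int. \<And>r. 0 < r \<Longrightarrow> r < 1 \<Longrightarrow>
      summable (\<lambda>N. ((\<Sum>n\<le>N. f n) - F1) * of_real r ^ N * complex_of_real (\<psi> (real N - n)))"
    by (rule boundary_behavior_conv[OF F bb]) (assumption | rule that)+
  define u where "u N = (\<Sum>n\<le>N. f n) - F1" for N
  note lim = lim0[folded u_def] and sum = sum0[folded u_def]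
  interpret positive_kernel "\<lambda>k. \<psi> (real_of_int k)" by (rule ker)
  interpret L: bounded_linear L by (rule L)
  define I where "I x = (LINT t|lborel. G t * complex_of_real (\<psi> (t - x)))" for x
  define g where "g n = L (- (I (real_of_int n) / complex_of_real (2 * pi)))" for n
  obtain M where M: "\<And>x. norm (I x) \<le> M"
    using bounded_pairing[OF P[OF PG] \<psi>] unfolding I_def by blast
  obtain K where K: "\<And>z. norm (L z) \<le> norm z * K" "K \<ge> 0" using L.nonneg_bounded by blast
  have gM: "\<bar>g n\<bar> \<le> M * K" for n
  proof -
    have "norm (I n / complex_of_real (2 * pi)) \<le> norm (I n)"
      using mult_left_mono[of 1 "2 * pi" "norm (I n)"] pi_ge_two by (simp add: norm_divide field_simps)
    then have "norm (- (I n / complex_of_real (2 * pi))) * K \<le> M * K"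
      using M[of n] K(2) by (intro mult_right_mono) auto
    then show ?thesis using K(1)[of "- (I n / complex_of_real (2 * pi))"] by (simp add: g_def)
  qed
  \<comment> \<open>The entry 1 gives positivity; - L (u 0) is included because the first partial
    sum is shifted by F1, so a bound on the coefficients alone does not control it.\<close>
  define B' where "B' = max 1 (max B (- L (u 0)))"
  have f_step: "u (Suc N) = u N + f (Suc N)" for N by (simp add: u_def)
  have glim: "((\<lambda>r. \<Sum>N. L (u N) * \<psi> (real_of_int (int N - n)) * r ^ N) \<longlongrightarrow> g n) (at_left 1)" for n
    using bounded_linear_Abel_conv(1)[OF L lim sum, of n] by (simp add: g_def I_def)
  have gsum: "summable (\<lambda>N. L (u N) * \<psi> (real_of_int (int N - n)) * r ^ N)" if "0 < r" "r < 1" for r n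
    using bounded_linear_Abel_conv(2)[OF L lim sum that, of n] by simp
  have B': "- B' \<le> L (u 0)" "L (u N) - B' \<le> L (u (Suc N))" "B' > 0" for N
    using lower[of "Suc N"] by (auto simp: B'_def f_step L.add)
  note tauberian = Abel_conv_tauberian[of B' "\<lambda>N. L (u N)", OF B' gsum glim gM]
  show "\<exists>R. \<forall>N. \<bar>L ((\<Sum>n\<le>N. f n) - F1)\<bar> \<le> R"
    using tauberian(1) by (simp add: u_def)
  show "(\<lambda>N. L ((\<Sum>n\<le>N. f n) - F1)) \<longlonglongrightarrow> 0"
    if pf: "\<And>G. P G \<Longrightarrow> pf_symbol G"
      and ev: "\<And>\<epsilon>. (\<epsilon>::real) > 0 \<Longrightarrow> \<forall>\<^sub>F n in sequentially. - \<epsilon> \<le> L (f n)"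
  proof -
    have "(\<lambda>N. L (u N)) \<longlonglongrightarrow> 0"
    proof (rule tauberian(2))
      fix \<epsilon> :: real assume "\<epsilon> > 0"
      from ev[OF this] have "\<forall>\<^sub>F N in sequentially. - \<epsilon> \<le> L (f (Suc N))"
        by (rule eventually_compose_filterlim) (rule filterlim_Suc)
      then show "\<forall>\<^sub>F N in sequentially. L (u N) - \<epsilon> \<le> L (u (Suc N))"
        by eventually_elim (simp add: f_step L.add)
    next
      have "((\<lambda>n::int. I (real_of_int n)) \<longlongrightarrow> 0) at_top"
        unfolding I_def by (rule filterlim_compose[OF pairing_tendsto_0[OF pf[OF PG] \<psi>] filterlim_real_of_int_at_top])
      then have "((\<lambda>n. L (- (I (real_of_int n) / complex_of_real (2 * pi)))) \<longlongrightarrow> L (- (0 / complex_of_real (2 * pi)))) at_top"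
        by (intro L.tendsto tendsto_intros) auto
      then show "(g \<longlongrightarrow> 0) at_top" by (simp add: g_def[abs_def] L.zero)
    qed
    then show ?thesis by (simp add: u_def)
  qed
qed

theorem theorem6p2:
  fixes c :: "nat \<Rightarrow> real" and F :: "complex \<Rightarrow> complex"
  assumes F: "\<And>z. z \<in> ball 0 1 \<Longrightarrow> (\<lambda>n. complex_of_real (c n) * z ^ n) sums F z"
  shows "((\<exists>B. \<forall>n. B \<le> c n) \<and> pseudomeasure_boundary (\<lambda>z. F z / (z - 1)) 0
            \<longrightarrow> (\<lambda>N. \<Sum>n\<le>N. c n) \<in> O(\<lambda>_. 1))
       \<and> (\<forall>F1. liminf (\<lambda>n. ereal (c n)) \<ge> 0 \<and>
               pseudofunction_boundary (\<lambda>z. (F z - F1) / (z - 1)) 0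
            \<longrightarrow> (\<lambda>n. complex_of_real (c n)) sums F1)"
proof (intro conjI impI allI)
  have F': "(\<lambda>n. complex_of_real (c n) * z ^ n) sums F z" if "norm z < 1" for z
    using F[of z] that by simp
  note taub = bounded_linear_boundary_tauberian[OF F']
  show "(\<lambda>N. \<Sum>n\<le>N. c n) \<in> O(\<lambda>_. 1)"
    if asm: "(\<exists>B. \<forall>n. B \<le> c n) \<and> pseudomeasure_boundary (\<lambda>z. F z / (z - 1)) 0"
  proof -
    obtain B where B: "\<And>n. B \<le> c n" using asm by blast
    \<comment> \<open>Part (i) is the case F1 = 0.\<close>
    have "pseudomeasure_boundary (\<lambda>z. (F z - 0) / (z - 1)) 0" using asm by simp
    have "\<exists>R. \<forall>N. \<bar>Re ((\<Sum>n\<le>N. complex_of_real (c n)) - 0)\<bar> \<le> R"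
      by (rule taub(1)[OF _ \<open>pseudomeasure_boundary (\<lambda>z. (F z - 0) / (z - 1)) 0\<close> _ bounded_linear_Re, of "- B"]) (use B in auto)
    then obtain R where "\<And>N. \<bar>Re ((\<Sum>n\<le>N. complex_of_real (c n)) - 0)\<bar> \<le> R" by blast
    then have "\<bar>\<Sum>n\<le>N. c n\<bar> \<le> R * 1" for N by simp
    then show ?thesis by (intro bigoI[where c = R]) simp
  qed
  fix F1
  assume asm: "0 \<le> liminf (\<lambda>n. ereal (c n)) \<and> pseudofunction_boundary (\<lambda>z. (F z - F1) / (z - 1)) 0"
  have ev: "\<forall>\<^sub>F n in sequentially. - \<epsilon> \<le> c n" if "\<epsilon> > 0" for \<epsilon>
  proof -
    have "ereal (- \<epsilon>) < liminf (\<lambda>n. ereal (c n))"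
      by (rule order_less_le_trans[of _ 0]) (use asm that in auto)
    then have "\<forall>\<^sub>F n in sequentially. ereal (- \<epsilon>) < ereal (c n)" by (rule less_LiminfD)
    then show ?thesis by eventually_elim simp
  qed
  obtain N where N: "\<And>n. n \<ge> N \<Longrightarrow> - 1 \<le> c n"
    using ev[of 1] by (auto simp: eventually_sequentially)
  \<comment> \<open>The finitely many terms before N are covered by the sum of their absolute
    values.\<close>
  obtain B where B: "\<And>n. - B \<le> c n"
  proof
    fix n
    show "- (1 + (\<Sum>n<N. \<bar>c n\<bar>)) \<le> c n"
    proof (cases "n < N")
      case True
      then have "\<bar>c n\<bar> \<le> (\<Sum>n<N. \<bar>c n\<bar>)" by (intro member_le_sum) auto
      then show ?thesis by linarith
    next
      case False
      then have "- 1 \<le> c n" using N by simp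
      moreover have "0 \<le> (\<Sum>n<N. \<bar>c n\<bar>)" by (intro sum_nonneg) auto
      ultimately show ?thesis by linarith
    qed
  qed
  have Re: "(\<lambda>N. Re ((\<Sum>n\<le>N. complex_of_real (c n)) - F1)) \<longlonglongrightarrow> 0"
    by (rule taub(2)[OF _ conjunct2[OF asm] _ bounded_linear_Re])
       (use B ev in \<open>auto simp: pf_symbol_def\<close>)
  \<comment> \<open>All coefficients have imaginary part 0, so the one-sided conditions hold
    trivially; the sequence is the constant - Im F1, and its limit 0 makes F1 real.\<close>
  have Im: "(\<lambda>N. Im ((\<Sum>n\<le>N. complex_of_real (c n)) - F1)) \<longlonglongrightarrow> 0"
    by (rule taub(2)[OF _ conjunct2[OF asm] _ bounded_linear_Im, of 0]) (auto simp: pf_symbol_def)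
  have "(\<lambda>N. (\<Sum>n\<le>N. complex_of_real (c n)) - F1) \<longlonglongrightarrow> 0"
    using Re Im by (simp add: tendsto_complex_iff)
  then show "(\<lambda>n. complex_of_real (c n)) sums F1"
    unfolding sums_def_le by (simp add: LIM_zero_iff)
qed

end
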